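(* Let $k\ge1$, $0\leqslant r\leqslant t$, and let $a_{-r},\dots,a_{-r+t}$ be elements of a commutative ring $\mathcal R$ with unity; let $x,y$ be indeterminates. Write $M=I_{(k+1)^t}-yK_t^{[k]}(a_{-r}x,\dots,a_{-r+t}x)$ and $Q_l=I_{|G_{l,t}^{[k]}|}-x\Pi_{l,t}^{[k]}(a_{-r},\dots,a_{-r+t})$. Then, as formal power series, \[ 1+\sum_{n=1}^\infty R\Bigl(x;\Bigl(\sum_{i=0}^ta_{-r+i}T_n^{(-r+i)}\Bigr)\otimes J_k\Bigr)y^n=(-1)^{\mathbf L(1^{\langle k\rangle},\dots,r^{\langle k\rangle})}\Bigl[\sum_{\substack{\overline\gamma\in\bigcup_{l=rk}^{kt}G_{l,t}^{[k]}\\ \{\overline\gamma\}\supseteq\{1^{\langle k\rangle},\dots,r^{\langle k\rangle}\}}}(-1)^{\mathbf L(\overline\gamma)}\det\bigl(M(\mathbf L(\overline\gamma)\mid\mathbf L(1^{\langle k\rangle},\dots,r^{\langle k\rangle}))\bigr)\Bigr](\det M)^{-1}, \] \[ \sum_{n=1}^\infty R\Bigl(x;\Bigl(\sum_{i=0}^ta_{-r+i}P_n^{-r+i}\Bigr)\otimes J_k\Bigr)y^n=-y\Bigl(\frac{d}{dy}\det M\Bigr)(\det M)^{-1}, \] \[ 1+\sum_{n=1}^\infty\operatorname{per}\Bigl(\Bigl(\sum_{i=0}^ta_{-r+i}T_n^{(-r+i)}\Bigr)\otimes J_k\Bigr)x^n=\det\bigl(Q_{rk}(\mathbf L(1^{\langle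 k\rangle},\dots,r^{\langle k\rangle})\mid\mathbf L(1^{\langle k\rangle},\dots,r^{\langle k\rangle}))\bigr)(\det Q_{rk})^{-1}, \] \[ \sum_{n=1}^\infty\operatorname{per}\Bigl(\Bigl(\sum_{i=0}^ta_{-r+i}P_n^{-r+i}\Bigr)\otimes J_k\Bigr)x^n=-x\sum_{l=0}^{kt}\Bigl(\frac{d}{dx}\det Q_l\Bigr)(\det Q_l)^{-1}. \]
   Context: For $s\in\mathbb Z$, $T_n^{(s)}=(b_{i,j})_{1\le i,j\le n}$ with $b_{i,j}=1$ if $j-i=s$ and $0$ otherwise. $P_n=(c_{i,j})$ with $c_{i,j}=1$ if $j-i\equiv1\pmod n$, else $0$. $J_k$ is the $k\times k$ all-ones matrix, $\otimes$ the Kronecker product, $I_N$ the identity. For an $m\times n$ matrix $A=(a_{i,j})$, $m\le n$, $R(x;A)=1+\sum_{j=1}^m x^j\sum_{S\subseteq\{1..m\},|S|=j}\sum_{\sigma:S\to\{1..n\}\text{ injective}}\prod_{i\in S}a_{i,\sigma(i)}$ (rook polynomial); $\operatorname{per}$ is the permanent. $i^{\langle l\rangle}$ denotes $i$ repeated $l$ times. $G_t^{[k]}=\{(1^{\langle l_1\rangle},\dots,t^{\langle l_t\rangle}):0\le l_i\le k\}$, $G_{r,t}^{[k]}$ the subset with $\sum l_i=r$. $\{\overline\alpha\}$ is the multiset of components of $\overline\alpha$, $\supseteq$ multiset inclusion. $\mathbf L$ is a fixed bijection from the relevant index set ($G_t^{[k]}$, resp. $G_{l,t}^{[k]}$) onto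 $\{1,\dots,N\}$, $N$ its size. For a square matrix $M$, $M(i\mid j)$ denotes the submatrix obtained by deleting row $i$ and column $j$. $K_t^{[k]}(a_0,\dots,a_t)$ (indexed by $G_t^{[k]}$): for $t=0$ the $1\times1$ matrix $\sum_{d=0}^kd!\binom kd^2a_0^d$; for $t\ge1$ and $\overline\alpha=(1^{\langle l_1\rangle},\dots,t^{\langle l_t\rangle})$, entry $(\overline\alpha,\overline\beta)$ is $\prod_{i=1}^{t-1}\binom{l_i}{p_i}\cdot\binom{k}{v-\sum p_i}a_0^{v-\sum p_i}\prod_{i=1}^{t-1}a_i^{p_i}\cdot\sum_{d=0}^{\min(l_t,k-v)}(d+v)!\binom{k}{d+v}\binom{l_t}da_t^d$ if $\overline\beta=(1^{\langle k-v+\sum_{i=1}^{t-1}p_i\rangle},2^{\langle l_1-p_1\rangle},\dots,t^{\langle l_{t-1}-p_{t-1}\rangle})$ with $0\le p_i\le l_i$, $\sum p_i\le v\le k$; $0$ otherwise. $\Pi_{r,t}^{[k]}(a_0,\dots,a_t)$ (indexed by $G_{r,t}^{[k]}$): $\Pi_{0,0}^{[k]}=k!a_0^k$; for $t\ge1$, $\overline\alpha=(1^{\langle l_1\rangle},\dots,t^{\langle l_t\rangle})\in G_{r,t}^{[k]}$, entry $(\overline\alpha,\overline\beta)$ is $k!\binom{k}{l_t+\sum p_i}\prod_{i=1}^{t-1}\binom{l_i}{p_i}\,a_0^{k-l_t-\sum p_i}\prod_{i=1}^{t-1}a_i^{p_i}\,a_t^{l_t}$ if $\overline\beta=(1^{\langle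 l_t+\sum_{i=1}^{t-1}p_i\rangle},2^{\langle l_1-p_1\rangle},\dots,t^{\langle l_{t-1}-p_{t-1}\rangle})$ with $0\le p_i\le l_i$, $\sum p_i\le k-l_t$; $0$ otherwise. *)

theory Defs
  imports
    "HOL-Computational_Algebra.Formal_Power_Series"
    "HOL-Number_Theory.Cong"
    "HOL-Library.FuncSet"
    "HOL-Library.Multiset"
    "Jordan_Normal_Form.Determinant"
begin

text \<open>Matrix rows and columns are numbered from 0, as in \<open>Jordan_Normal_Form\<close>; conditions on
  the difference of a column and a row index do not depend on this.\<close>

definition toeplitz_unit :: "nat \<Rightarrow> int \<Rightarrow> 'a::comm_ring_1 mat" where
  "toeplitz_unit n s = mat n n (\<lambda>(i, j). if int j - int i = s then 1 else 0)"

definition cyclic_mat :: "nat \<Rightarrow> 'a::comm_ring_1 mat" where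
  "cyclic_mat n = mat n n (\<lambda>(i, j). if [int j - int i = 1] (mod int n) then 1 else 0)"

definition ones_mat :: "nat \<Rightarrow> 'a::comm_ring_1 mat" where
  "ones_mat k = mat k k (\<lambda>_. 1)"

definition kronecker :: "'a::comm_ring_1 mat \<Rightarrow> 'a mat \<Rightarrow> 'a mat" where
  "kronecker A B = mat (dim_row A * dim_row B) (dim_col A * dim_col B)
     (\<lambda>(i, j). A $$ (i div dim_row B, j div dim_col B) * B $$ (i mod dim_row B, j mod dim_col B))"

definition inverse_mat :: "'a::comm_ring_1 mat \<Rightarrow> 'a mat" where
  "inverse_mat A = (THE B. B \<in> carrier_mat (dim_row A) (dim_row A) \<and> inverts_mat A B \<and> inverts_mat B A)"

definition int_pow_mat :: "'a::comm_ring_1 mat \<Rightarrow> int \<Rightarrow> 'a mat" where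
  "int_pow_mat A s = (if 0 \<le> s then A ^\<^sub>m nat s else inverse_mat A ^\<^sub>m nat (- s))"

definition mat_sum :: "nat \<Rightarrow> ('i \<Rightarrow> 'a::comm_ring_1 mat) \<Rightarrow> 'i set \<Rightarrow> 'a mat" where
  "mat_sum n F I = mat n n (\<lambda>(i, j). \<Sum>l\<in>I. F l $$ (i, j))"

text \<open>The rook polynomial is meant for matrices with at least as many columns as rows.\<close>

definition rook_poly :: "'a::comm_ring_1 mat \<Rightarrow> 'a poly" where
  "rook_poly A = 1 + (\<Sum>j = 1..dim_row A.
     monom (\<Sum>S | S \<subseteq> {0..<dim_row A} \<and> card S = j.
              \<Sum>\<sigma> | \<sigma> \<in> S \<rightarrow>\<^sub>E {0..<dim_col A} \<and> inj_on \<sigma> S. \<Prod>i\<in>S. A $$ (i, \<sigma> i)) j)"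

text \<open>Permanent of a square matrix.\<close>

definition per :: "'a::comm_ring_1 mat \<Rightarrow> 'a" where
  "per A = (\<Sum>p | p permutes {0..<dim_row A}. \<Prod>i = 0..<dim_row A. A $$ (i, p i))"

text \<open>\<open>series_from_1 f\<close> is the sum of \<open>f n * X ^ n\<close> over \<open>n \<ge> 1\<close>.\<close>

definition series_from_1 :: "(nat \<Rightarrow> 'a::comm_ring_1) \<Rightarrow> 'a fps" where
  "series_from_1 f = Abs_fps (\<lambda>n. if n = 0 then 0 else f n)"

text \<open>The inverse of a power series with constant coefficient 1. The overloaded \<open>inverse\<close> on
  power series requires an inverse operation on the coefficients, which polynomials lack.\<close>

definition fps_inv1 :: "'a::comm_ring_1 fps \<Rightarrow> 'a fps" where
  "fps_inv1 f = fps_right_inverse f 1"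

lemma fps_inv1: "fps_nth f 0 = 1 \<Longrightarrow> f * fps_inv1 f = 1"
  unfolding fps_inv1_def by (rule fps_right_inverse) simp

definition char_series_mat :: "nat \<Rightarrow> 'a::comm_ring_1 mat \<Rightarrow> 'a fps mat" where
  "char_series_mat N A = 1\<^sub>m N - fps_X \<cdot>\<^sub>m map_mat fps_const A"

lemma det_char_series_mat_nth_0:
  assumes "A \<in> carrier_mat N N"
  shows "fps_nth (det (char_series_mat N A)) 0 = 1"
proof -
  interpret h: comm_ring_hom "\<lambda>f :: 'a fps. fps_nth f 0"
    by unfold_locales auto
  have "map_mat (\<lambda>f. fps_nth f 0) (char_series_mat N A) = 1\<^sub>m N"
    using assms by (intro eq_matI) (auto simp: char_series_mat_def)
  then show ?thesis
    by (metis h.hom_det det_one)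
qed

text \<open>\<open>mult_seq t l\<close> is the sequence in which 1 is repeated \<open>l 1\<close> times, then 2 is repeated
  \<open>l 2\<close> times, and so on up to \<open>t\<close>.\<close>

definition mult_seq :: "nat \<Rightarrow> (nat \<Rightarrow> nat) \<Rightarrow> nat list" where
  "mult_seq t l = concat (map (\<lambda>i. replicate (l i) i) [1..<Suc t])"

definition G_set :: "nat \<Rightarrow> nat \<Rightarrow> nat list set" where
  "G_set k t = {mult_seq t l | l. \<forall>i\<in>{1..t}. l i \<le> k}"

definition G_lev :: "nat \<Rightarrow> nat \<Rightarrow> nat \<Rightarrow> nat list set" where
  "G_lev k r t = {mult_seq t l | l. (\<forall>i\<in>{1..t}. l i \<le> k) \<and> (\<Sum>i = 1..t. l i) = r}"

text \<open>\<open>shift_seq t \<alpha> m p\<close> is the column index with \<open>m\<close> copies of 1 and, for \<open>1 \<le> i < t\<close>,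
  \<open>l\<^sub>i - p\<^sub>i\<close> copies of \<open>i + 1\<close>, where \<open>l\<^sub>i\<close> is the multiplicity of \<open>i\<close> in \<open>\<alpha>\<close>.\<close>

definition shift_seq :: "nat \<Rightarrow> nat list \<Rightarrow> nat \<Rightarrow> (nat \<Rightarrow> nat) \<Rightarrow> nat list" where
  "shift_seq t \<alpha> m p = mult_seq t (\<lambda>j. if j = 1 then m else count_list \<alpha> (j - 1) - p (j - 1))"

definition K_adm :: "nat \<Rightarrow> nat \<Rightarrow> nat list \<Rightarrow> nat list \<Rightarrow> (nat \<Rightarrow> nat) \<Rightarrow> nat \<Rightarrow> bool" where
  "K_adm k t \<alpha> \<beta> p v \<longleftrightarrow>
     (\<forall>i\<in>{1..<t}. p i \<le> count_list \<alpha> i) \<and> (\<Sum>i = 1..<t. p i) \<le> v \<and> v \<le> k \<and>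
     \<beta> = shift_seq t \<alpha> (k - v + (\<Sum>i = 1..<t. p i)) p"

definition K_val :: "nat \<Rightarrow> nat \<Rightarrow> (nat \<Rightarrow> 'a::comm_ring_1) \<Rightarrow> nat list \<Rightarrow> (nat \<Rightarrow> nat) \<Rightarrow> nat \<Rightarrow> 'a" where
  "K_val k t a \<alpha> p v =
     of_nat (\<Prod>i = 1..<t. count_list \<alpha> i choose p i) *
     of_nat (k choose (v - (\<Sum>i = 1..<t. p i))) * a 0 ^ (v - (\<Sum>i = 1..<t. p i)) *
     (\<Prod>i = 1..<t. a i ^ p i) *
     (\<Sum>d = 0..min (count_list \<alpha> t) (k - v).
        of_nat (fact (d + v) * (k choose (d + v)) * (count_list \<alpha> t choose d)) * a t ^ d)"

text \<open>The column index determines the numbers \<open>p\<^sub>i\<close> (for \<open>1 \<le> i < t\<close>) and \<open>v\<close>, and in the two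
  entry functions below they are solved for. The lemmas \<open>K_entry_eq\<close>, \<open>K_entry_eq_0\<close>,
  \<open>Pi_entry_eq\<close> and \<open>Pi_entry_eq_0\<close> state the entries for arbitrary admissible \<open>p\<close> and \<open>v\<close>.\<close>

definition p_of :: "nat list \<Rightarrow> nat list \<Rightarrow> nat \<Rightarrow> nat" where
  "p_of \<alpha> \<beta> i = count_list \<alpha> i - count_list \<beta> (Suc i)"

definition v_of :: "nat \<Rightarrow> nat \<Rightarrow> nat list \<Rightarrow> nat list \<Rightarrow> nat" where
  "v_of k t \<alpha> \<beta> = k + (\<Sum>i = 1..<t. p_of \<alpha> \<beta> i) - count_list \<beta> 1"

definition K_entry :: "nat \<Rightarrow> nat \<Rightarrow> (nat \<Rightarrow> 'a::comm_ring_1) \<Rightarrow> nat list \<Rightarrow> nat list \<Rightarrow> 'a" where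
  "K_entry k t a \<alpha> \<beta> =
     (if t = 0 then (\<Sum>d = 0..k. of_nat (fact d * (k choose d)\<^sup>2) * a 0 ^ d)
      else if K_adm k t \<alpha> \<beta> (p_of \<alpha> \<beta>) (v_of k t \<alpha> \<beta>)
      then K_val k t a \<alpha> (p_of \<alpha> \<beta>) (v_of k t \<alpha> \<beta>) else 0)"

definition Pi_adm :: "nat \<Rightarrow> nat \<Rightarrow> nat list \<Rightarrow> nat list \<Rightarrow> (nat \<Rightarrow> nat) \<Rightarrow> bool" where
  "Pi_adm k t \<alpha> \<beta> p \<longleftrightarrow>
     (\<forall>i\<in>{1..<t}. p i \<le> count_list \<alpha> i) \<and> count_list \<alpha> t + (\<Sum>i = 1..<t. p i) \<le> k \<and>
     \<beta> = shift_seq t \<alpha> (count_list \<alpha> t + (\<Sum>i = 1..<t. p i)) p"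

definition Pi_val :: "nat \<Rightarrow> nat \<Rightarrow> (nat \<Rightarrow> 'a::comm_ring_1) \<Rightarrow> nat list \<Rightarrow> (nat \<Rightarrow> nat) \<Rightarrow> 'a" where
  "Pi_val k t a \<alpha> p =
     of_nat (fact k * (k choose (count_list \<alpha> t + (\<Sum>i = 1..<t. p i))) *
             (\<Prod>i = 1..<t. count_list \<alpha> i choose p i)) *
     a 0 ^ (k - count_list \<alpha> t - (\<Sum>i = 1..<t. p i)) *
     (\<Prod>i = 1..<t. a i ^ p i) * a t ^ count_list \<alpha> t"

definition Pi_entry :: "nat \<Rightarrow> nat \<Rightarrow> (nat \<Rightarrow> 'a::comm_ring_1) \<Rightarrow> nat list \<Rightarrow> nat list \<Rightarrow> 'a" where
  "Pi_entry k t a \<alpha> \<beta> =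
     (if t = 0 then of_nat (fact k) * a 0 ^ k
      else if Pi_adm k t \<alpha> \<beta> (p_of \<alpha> \<beta>) then Pi_val k t a \<alpha> (p_of \<alpha> \<beta>) else 0)"

lemma count_mult_seq: "count_list (mult_seq t l) j = (if 1 \<le> j \<and> j \<le> t then l j else 0)"
proof (induction t)
  case 0
  then show ?case by (simp add: mult_seq_def)
next
  case (Suc t)
  have "count_list (replicate m i) j = (if i = j then m else 0)" for m i :: nat
    by (induction m) auto
  moreover have "mult_seq (Suc t) l = mult_seq t l @ replicate (l (Suc t)) (Suc t)"
    by (simp add: mult_seq_def)
  ultimately show ?case using Suc by auto
qed

lemma p_of_shift_seq:
  assumes "p i \<le> count_list \<alpha> i" "i \<in> {1..<t}"
  shows "p_of \<alpha> (shift_seq t \<alpha> m p) i = p i"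
  using assms by (auto simp: p_of_def shift_seq_def count_mult_seq)

lemma shift_seq_cong:
  assumes "\<And>i. i \<in> {1..<t} \<Longrightarrow> p i = q i"
  shows "shift_seq t \<alpha> m p = shift_seq t \<alpha> m q"
proof -
  have "p (j - 1) = q (j - 1)" if "j \<in> set [1..<Suc t]" "j \<noteq> 1" for j
    using that by (intro assms) auto
  then show ?thesis
    unfolding shift_seq_def mult_seq_def
    by (intro arg_cong[where f = concat] map_cong) auto
qed

lemma K_entry_eq:
  assumes "1 \<le> t" and adm: "K_adm k t \<alpha> \<beta> p v"
  shows "K_entry k t a \<alpha> \<beta> = K_val k t a \<alpha> p v"
proof -
  have p: "p_of \<alpha> \<beta> i = p i" if "i \<in> {1..<t}" for i
    using adm p_of_shift_seq[OF _ that] that unfolding K_adm_def by blast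
  have s: "(\<Sum>i = 1..<t. p_of \<alpha> \<beta> i) = (\<Sum>i = 1..<t. p i)"
    by (intro sum.cong) (auto simp: p)
  have "count_list \<beta> 1 = k - v + (\<Sum>i = 1..<t. p i)"
    using adm \<open>1 \<le> t\<close> by (auto simp: K_adm_def shift_seq_def count_mult_seq)
  then have v: "v_of k t \<alpha> \<beta> = v"
    using adm unfolding v_of_def s K_adm_def by linarith
  have "K_adm k t \<alpha> \<beta> (p_of \<alpha> \<beta>) v"
    using adm shift_seq_cong[of t "p_of \<alpha> \<beta>" p] p s by (auto simp: K_adm_def)
  moreover have "K_val k t a \<alpha> (p_of \<alpha> \<beta>) v = K_val k t a \<alpha> p v"
    unfolding K_val_def s using p by simp
  ultimately show ?thesis using \<open>1 \<le> t\<close> by (simp add: K_entry_def v)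
qed

lemma K_entry_eq_0:
  assumes "1 \<le> t" "\<nexists>p v. K_adm k t \<alpha> \<beta> p v"
  shows "K_entry k t a \<alpha> \<beta> = 0"
  using assms by (auto simp: K_entry_def)

lemma Pi_entry_eq:
  assumes "1 \<le> t" and adm: "Pi_adm k t \<alpha> \<beta> p"
  shows "Pi_entry k t a \<alpha> \<beta> = Pi_val k t a \<alpha> p"
proof -
  have p: "p_of \<alpha> \<beta> i = p i" if "i \<in> {1..<t}" for i
    using adm p_of_shift_seq[OF _ that] that unfolding Pi_adm_def by blast
  have s: "(\<Sum>i = 1..<t. p_of \<alpha> \<beta> i) = (\<Sum>i = 1..<t. p i)"
    by (intro sum.cong) (auto simp: p)
  have "Pi_adm k t \<alpha> \<beta> (p_of \<alpha> \<beta>)"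
    using adm shift_seq_cong[of t "p_of \<alpha> \<beta>" p] p s by (auto simp: Pi_adm_def)
  moreover have "Pi_val k t a \<alpha> (p_of \<alpha> \<beta>) = Pi_val k t a \<alpha> p"
    unfolding Pi_val_def s using p by simp
  ultimately show ?thesis using \<open>1 \<le> t\<close> by (simp add: Pi_entry_def)
qed

lemma Pi_entry_eq_0:
  assumes "1 \<le> t" "\<nexists>p. Pi_adm k t \<alpha> \<beta> p"
  shows "Pi_entry k t a \<alpha> \<beta> = 0"
  using assms by (auto simp: Pi_entry_def)

text \<open>\<open>L\<close> numbers the index set \<open>S\<close> by \<open>1, \<dots>, card S\<close>, hence the shift by one here and in
  \<open>submat_del\<close>.\<close>

definition numbering :: "('i \<Rightarrow> nat) \<Rightarrow> 'i set \<Rightarrow> bool" where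
  "numbering L S \<longleftrightarrow> bij_betw L S {1..card S}"

definition indexed_mat :: "('i \<Rightarrow> nat) \<Rightarrow> 'i set \<Rightarrow> ('i \<Rightarrow> 'i \<Rightarrow> 'a) \<Rightarrow> 'a mat" where
  "indexed_mat L S f =
     mat (card S) (card S) (\<lambda>(i, j). f (inv_into S L (Suc i)) (inv_into S L (Suc j)))"

definition submat_del :: "'a mat \<Rightarrow> nat \<Rightarrow> nat \<Rightarrow> 'a mat" where
  "submat_del A i j = mat_delete A (i - 1) (j - 1)"

definition K_mat :: "(nat list \<Rightarrow> nat) \<Rightarrow> nat \<Rightarrow> nat \<Rightarrow> (nat \<Rightarrow> 'a::comm_ring_1) \<Rightarrow> 'a mat" where
  "K_mat L k t a = indexed_mat L (G_set k t) (K_entry k t a)"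

definition Pi_mat :: "(nat list \<Rightarrow> nat) \<Rightarrow> nat \<Rightarrow> nat \<Rightarrow> nat \<Rightarrow> (nat \<Rightarrow> 'a::comm_ring_1) \<Rightarrow> 'a mat" where
  "Pi_mat L k l t a = indexed_mat L (G_lev k l t) (Pi_entry k t a)"

end

theory Submission
  imports Defs
begin

text \<open>Block column e of the band stands for column block e - r of the Toeplitz matrix. The
  fictitious blocks on its right can be ruled out at the start by giving them no columns. Those on
  its left cannot: a transfer step takes every block that enters the window to be full, so that they
  stayed empty is visible only in the end state. This is the source of the sum over all supersets of
  \<open>1\<^sup>k \<dots> r\<^sup>k\<close>.

  For circulants the obstacle is that the same columns occur at both ends of the sweep, and
  repeatedly if n is at most t, so free columns cannot be followed along it. Numbers of rooks need
  no such history: \<open>usage_op\<close> separates placing rooks from capacities. For each vector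
  of usages exactly one initial state is reproduced at the end, so the trace counts nothing twice.

  A block row with k rooks never increases the number of free columns in the window, and keeps it
  only if the block that leaves is exhausted. Hence the triangular shape behind the permanents.

  Determinants enter through the adjugate of I - yA and Jacobi's formula for the derivative of a
  determinant; neither divides in the coefficient ring.\<close>

text \<open>Process the block rows of the matrix from the last to the first. A block row meets only
  \<open>t + 1\<close> consecutive block columns, and how many placements extend a partial one depends only on the
  numbers of free columns in these blocks; after dropping the block that leaves the window, these
  numbers are the state \<open>\<alpha>\<close> (\<open>i\<close> occurs in \<open>\<alpha>\<close> as often as block \<open>i\<close> has free columns), and \<open>K\<close> is the
  transfer matrix. Hence the rook polynomial of the Toeplitz matrix is a sum of entries of \<open>K\<^sup>n\<close> from the
  state \<open>1\<^sup>k \<dots> r\<^sup>k\<close> to the states in which the fictitious columns on the left are still free.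

  For the circulant matrix, place the rooks on a cover of the cyclic matrix by a band of width
  \<open>n + t\<close> and record only how many rooks use each block column. Placing \<open>m\<close> rooks in a block with \<open>f\<close> free
  columns contributes the falling factorial of \<open>f\<close> of length \<open>m\<close>; along a residue class modulo \<open>n\<close> these
  factors telescope to the correct count when the state at the end equals the state at the
  beginning, which gives the trace of \<open>K\<^sup>n\<close>.

  The permanent is the coefficient of \<open>x\<^bsup>kn\<^esup>\<close> in the rook polynomial, so that only the coefficient
  of \<open>x\<^sup>k\<close> in \<open>K\<close> matters for it.\<close>

subsection \<open>Powers of matrices and the resolvent\<close>

text \<open>Entries of matrix powers as sums over paths in the index set itself, so that the
  numbering \<open>L\<close> stays out of the combinatorics. \<open>indexed_mat_pow\<close> is the
  bridge.\<close>

fun walk :: "'i set \<Rightarrow> ('i \<Rightarrow> 'i \<Rightarrow> 'a::comm_ring_1) \<Rightarrow> nat \<Rightarrow> 'i \<Rightarrow> 'i \<Rightarrow> 'a" where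
  "walk S f 0 \<alpha> \<beta> = (if \<alpha> = \<beta> then 1 else 0)"
| "walk S f (Suc n) \<alpha> \<beta> = (\<Sum>\<gamma>\<in>S. f \<alpha> \<gamma> * walk S f n \<gamma> \<beta>)"

lemma pow_mat_Suc_left:
  assumes "A \<in> carrier_mat n n"
  shows "A ^\<^sub>m Suc m = A * A ^\<^sub>m m"
proof (induction m)
  case 0
  then show ?case using assms by simp
next
  case (Suc m)
  have "A ^\<^sub>m Suc (Suc m) = (A * A ^\<^sub>m m) * A"
    using Suc by simp
  also have "\<dots> = A * (A ^\<^sub>m m * A)"
    using assms by (intro assoc_mult_mat[of _ n n _ n _ n]) auto
  finally show ?case by simp
qed

lemma numbering_bounds:
  assumes "numbering L S" "\<alpha> \<in> S"
  shows "1 \<le> L \<alpha>" "L \<alpha> - 1 < card S" "inv_into S L (Suc (L \<alpha> - 1)) = \<alpha>"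
proof -
  have "L \<alpha> \<in> {1..card S}"
    using assms unfolding numbering_def bij_betw_def by blast
  then show b: "1 \<le> L \<alpha>" and "L \<alpha> - 1 < card S"
    by auto
  show "inv_into S L (Suc (L \<alpha> - 1)) = \<alpha>"
    using b assms unfolding numbering_def bij_betw_def by simp
qed

lemma sum_numbering:
  assumes "numbering L S"
  shows "(\<Sum>i<card S. g (inv_into S L (Suc i))) = (\<Sum>\<alpha>\<in>S. g \<alpha>)"
proof -
  have b: "bij_betw (inv_into S L) {1..card S} S"
    using assms unfolding numbering_def by (rule bij_betw_inv_into)
  have "bij_betw Suc {..<card S} {1..card S}"
    by (auto simp: bij_betw_def image_Suc_lessThan)
  from bij_betw_trans[OF this b] show ?thesis
    by (intro sum.reindex_bij_betw) (simp add: o_def)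
qed

lemma indexed_mat_pow:
  assumes num: "numbering L S" and "\<alpha> \<in> S" "\<beta> \<in> S"
  shows "(indexed_mat L S f ^\<^sub>m n) $$ (L \<alpha> - 1, L \<beta> - 1) = walk S f n \<alpha> \<beta>"
  using \<open>\<alpha> \<in> S\<close>
proof (induction n arbitrary: \<alpha>)
  case 0
  have "L \<alpha> - 1 = L \<beta> - 1 \<longleftrightarrow> \<alpha> = \<beta>"
    using numbering_bounds[OF num 0] numbering_bounds[OF num \<open>\<beta> \<in> S\<close>] by metis
  then show ?case
    using numbering_bounds[OF num 0] numbering_bounds[OF num \<open>\<beta> \<in> S\<close>]
    by (auto simp: indexed_mat_def)
next
  case (Suc n)
  let ?A = "indexed_mat L S f" and ?N = "card S" and ?\<iota> = "\<lambda>i. inv_into S L (Suc i)"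
  have A: "?A \<in> carrier_mat ?N ?N"
    by (simp add: indexed_mat_def)
  have \<iota>: "?\<iota> i \<in> S" "L (?\<iota> i) - 1 = i" if "i < ?N" for i
  proof -
    have "Suc i \<in> L ` S"
      using num that unfolding numbering_def bij_betw_def by auto
    then show "?\<iota> i \<in> S" "L (?\<iota> i) - 1 = i"
      by (auto simp: inv_into_into f_inv_into_f)
  qed
  have "(?A ^\<^sub>m Suc n) $$ (L \<alpha> - 1, L \<beta> - 1) = (?A * ?A ^\<^sub>m n) $$ (L \<alpha> - 1, L \<beta> - 1)"
    by (simp only: pow_mat_Suc_left[OF A])
  also have "\<dots> = (\<Sum>i<?N. ?A $$ (L \<alpha> - 1, i) * (?A ^\<^sub>m n) $$ (i, L \<beta> - 1))"
    using numbering_bounds[OF num Suc.prems] numbering_bounds[OF num \<open>\<beta> \<in> S\<close>] A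
    by (auto simp: times_mat_def scalar_prod_def lessThan_atLeast0)
  also have "\<dots> = (\<Sum>i<?N. f \<alpha> (?\<iota> i) * walk S f n (?\<iota> i) \<beta>)"
  proof (intro sum.cong refl)
    fix i assume "i \<in> {..<?N}"
    then have i: "i < ?N" by simp
    have "(?A ^\<^sub>m n) $$ (i, L \<beta> - 1) = walk S f n (?\<iota> i) \<beta>"
      using Suc.IH[OF \<iota>(1)[OF i]] \<iota>(2)[OF i] by simp
    moreover have "?A $$ (L \<alpha> - 1, i) = f \<alpha> (?\<iota> i)"
      using numbering_bounds[OF num Suc.prems] i by (simp add: indexed_mat_def)
    ultimately show "?A $$ (L \<alpha> - 1, i) * (?A ^\<^sub>m n) $$ (i, L \<beta> - 1) = f \<alpha> (?\<iota> i) * walk S f n (?\<iota> i) \<beta>"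
      by simp
  qed
  also have "\<dots> = (\<Sum>\<gamma>\<in>S. f \<alpha> \<gamma> * walk S f n \<gamma> \<beta>)"
    by (rule sum_numbering[OF num])
  finally show ?case by simp
qed

text \<open>The geometric series of A in the series variable, that is, the inverse of I -
  yA.\<close>

definition resolvent_mat :: "nat \<Rightarrow> 'a::comm_ring_1 mat \<Rightarrow> 'a fps mat" where
  "resolvent_mat N A = mat N N (\<lambda>(i, j). Abs_fps (\<lambda>n. (A ^\<^sub>m n) $$ (i, j)))"

lemma char_series_mat_carrier:
  "A \<in> carrier_mat N N \<Longrightarrow> char_series_mat N A \<in> carrier_mat N N"
  unfolding char_series_mat_def by (intro carrier_matI) auto

lemma char_series_mat_resolvent:
  assumes A: "A \<in> carrier_mat N N"
  shows "char_series_mat N A * resolvent_mat N A = 1\<^sub>m N"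
proof (intro eq_matI)
  fix i j assume ij: "i < dim_row (1\<^sub>m N)" "j < dim_col (1\<^sub>m N)"
  let ?H = "resolvent_mat N A"
  have H: "fps_nth (?H $$ (l, j)) n = (A ^\<^sub>m n) $$ (l, j)" if "l < N" for l n
    using that ij by (simp add: resolvent_mat_def)
  have "(char_series_mat N A * ?H) $$ (i, j) = (\<Sum>l<N. char_series_mat N A $$ (i, l) * ?H $$ (l, j))"
    using ij A
    by (simp add: times_mat_def scalar_prod_def char_series_mat_def resolvent_mat_def lessThan_atLeast0)
  also have "\<dots> = (\<Sum>l<N. (if i = l then ?H $$ (l, j) else 0)
                     - fps_X * (fps_const (A $$ (i, l)) * ?H $$ (l, j)))"
    using ij A by (intro sum.cong) (auto simp: char_series_mat_def algebra_simps)
  also have "\<dots> = ?H $$ (i, j) - fps_X * (\<Sum>l<N. fps_const (A $$ (i, l)) * ?H $$ (l, j))"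
    using ij by (simp add: sum_subtractf sum_distrib_left)
  also have "\<dots> = 1\<^sub>m N $$ (i, j)"
  proof (rule fps_ext)
    fix n
    show "fps_nth (?H $$ (i, j) - fps_X * (\<Sum>l<N. fps_const (A $$ (i, l)) * ?H $$ (l, j))) n =
          fps_nth (1\<^sub>m N $$ (i, j)) n"
    proof (cases n)
      case 0
      then show ?thesis using ij A by (simp add: H)
    next
      case (Suc m)
      have "(A ^\<^sub>m Suc m) $$ (i, j) = (\<Sum>l<N. A $$ (i, l) * (A ^\<^sub>m m) $$ (l, j))"
        unfolding pow_mat_Suc_left[OF A] using ij A
        by (simp add: times_mat_def scalar_prod_def lessThan_atLeast0)
      then show ?thesis
        using ij Suc by (simp add: H fps_sum_nth del: pow_mat.simps)
    qed
  qed
  finally show "(char_series_mat N A * ?H) $$ (i, j) = 1\<^sub>m N $$ (i, j)" .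
qed (use A in \<open>auto simp: char_series_mat_def resolvent_mat_def\<close>)

text \<open>With M = I - yA and its right inverse H, adj M = (adj M) M H = (det M) H. Only the
  adjugate identity is used, so any commutative ring will do.\<close>

lemma adj_mat_char_series_mat:
  assumes A: "A \<in> carrier_mat N N"
  shows "adj_mat (char_series_mat N A) = det (char_series_mat N A) \<cdot>\<^sub>m resolvent_mat N A"
proof -
  let ?M = "char_series_mat N A" and ?H = "resolvent_mat N A"
  have M: "?M \<in> carrier_mat N N" and H: "?H \<in> carrier_mat N N"
    using char_series_mat_carrier[OF A] by (simp_all add: resolvent_mat_def)
  note adj = adj_mat[OF M]
  have "adj_mat ?M = adj_mat ?M * (?M * ?H)"
    using adj(1) by (simp add: char_series_mat_resolvent[OF A])
  also have "\<dots> = (adj_mat ?M * ?M) * ?H"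
    using assoc_mult_mat[OF adj(1) M H] by simp
  also have "\<dots> = (det ?M \<cdot>\<^sub>m 1\<^sub>m N) * ?H"
    by (simp add: adj(3))
  also have "\<dots> = det ?M \<cdot>\<^sub>m (1\<^sub>m N * ?H)"
    using H by (intro mult_smult_assoc_mat[of _ N N _ N]) auto
  also have "\<dots> = det ?M \<cdot>\<^sub>m ?H"
    using H by simp
  finally show ?thesis .
qed

text \<open>The indices are swapped because the adjugate is the transpose of the matrix of
  cofactors.\<close>

lemma cofactor_char_series_mat:
  assumes A: "A \<in> carrier_mat N N" and "i < N" "j < N"
  shows "cofactor (char_series_mat N A) j i =
    det (char_series_mat N A) * Abs_fps (\<lambda>n. (A ^\<^sub>m n) $$ (i, j))"
proof -
  have "cofactor (char_series_mat N A) j i = adj_mat (char_series_mat N A) $$ (i, j)"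
    using assms by (simp add: adj_mat_def char_series_mat_def)
  then show ?thesis
    unfolding adj_mat_char_series_mat[OF A] using assms by (simp add: resolvent_mat_def)
qed

lemma resolvent_cofactor:
  assumes A: "A \<in> carrier_mat N N" and "i < N" "j < N"
  shows "Abs_fps (\<lambda>n. (A ^\<^sub>m n) $$ (i, j)) =
    cofactor (char_series_mat N A) j i * fps_inv1 (det (char_series_mat N A))"
proof -
  let ?d = "det (char_series_mat N A)"
  have "?d * f * fps_inv1 ?d = ?d * fps_inv1 ?d * f" for f
    by (simp add: mult_ac)
  then show ?thesis
    unfolding cofactor_char_series_mat[OF assms] fps_inv1[OF det_char_series_mat_nth_0[OF A]]
    by simp
qed

section \<open>Jacobi's formula and the series of traces\<close>

lemma fps_deriv_prod:
  fixes f :: "'i \<Rightarrow> 'a::comm_ring_1 fps"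
  assumes "finite S"
  shows "fps_deriv (prod f S) = (\<Sum>i\<in>S. fps_deriv (f i) * prod f (S - {i}))"
  using assms
proof (induction S)
  case (insert x S)
  have "(\<Sum>i\<in>S. fps_deriv (f i) * prod f (insert x S - {i})) =
        f x * (\<Sum>i\<in>S. fps_deriv (f i) * prod f (S - {i}))"
    unfolding sum_distrib_left
  proof (intro sum.cong refl)
    fix i assume i: "i \<in> S"
    then have "insert x S - {i} = insert x (S - {i})" using insert by auto
    then show "fps_deriv (f i) * prod f (insert x S - {i}) = f x * (fps_deriv (f i) * prod f (S - {i}))"
      using insert by (simp add: mult_ac)
  qed
  then show ?case using insert by (simp add: algebra_simps)
qed simp

text \<open>By the product rule the derivative of det M is the sum of the determinants of
  \<open>R i\<close>, in which row i alone is differentiated; each of them is expanded along that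
  row.\<close>

lemma fps_deriv_det:
  fixes M :: "'a::comm_ring_1 fps mat"
  assumes M: "M \<in> carrier_mat N N"
  shows "fps_deriv (det M) = (\<Sum>i<N. \<Sum>j<N. fps_deriv (M $$ (i, j)) * cofactor M i j)"
proof -
  define R where "R i = mat N N (\<lambda>(i', j). if i' = i then fps_deriv (M $$ (i', j)) else M $$ (i', j))" for i
  have R: "R i \<in> carrier_mat N N" for i by (simp add: R_def)
  have sg: "fps_deriv (signof p * f) = signof p * fps_deriv f" for p :: "nat \<Rightarrow> nat" and f :: "'a fps"
    by (simp add: sign_def)
  have "fps_deriv (det M) = (\<Sum>p | p permutes {0..<N}. signof p *
      (\<Sum>i\<in>{0..<N}. fps_deriv (M $$ (i, p i)) * (\<Prod>i'\<in>{0..<N} - {i}. M $$ (i', p i'))))"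
    unfolding det_def'[OF M] fps_deriv_sum sg by (simp add: fps_deriv_prod)
  also have "\<dots> = (\<Sum>i\<in>{0..<N}. \<Sum>p | p permutes {0..<N}. signof p *
      (fps_deriv (M $$ (i, p i)) * (\<Prod>i'\<in>{0..<N} - {i}. M $$ (i', p i'))))"
    unfolding sum_distrib_left by (rule sum.swap)
  also have "\<dots> = (\<Sum>i\<in>{0..<N}. det (R i))"
  proof (intro sum.cong refl)
    fix i assume i: "i \<in> {0..<N}"
    show "(\<Sum>p | p permutes {0..<N}. signof p *
      (fps_deriv (M $$ (i, p i)) * (\<Prod>i'\<in>{0..<N} - {i}. M $$ (i', p i')))) = det (R i)"
      unfolding det_def'[OF R]
    proof (intro sum.cong refl arg_cong2[where f = "(*)"])
      fix p assume "p \<in> {p. p permutes {0..<N}}"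
      then have p: "p x < N" if "x < N" for x
        using that permutes_in_image[of p "{0..<N}" x] by auto
      have "(\<Prod>i' = 0..<N. R i $$ (i', p i')) = R i $$ (i, p i) * (\<Prod>i'\<in>{0..<N} - {i}. R i $$ (i', p i'))"
        using i by (intro prod.remove) auto
      also have "(\<Prod>i'\<in>{0..<N} - {i}. R i $$ (i', p i')) = (\<Prod>i'\<in>{0..<N} - {i}. M $$ (i', p i'))"
        using p by (intro prod.cong) (auto simp: R_def)
      finally show "fps_deriv (M $$ (i, p i)) * (\<Prod>i'\<in>{0..<N} - {i}. M $$ (i', p i')) = (\<Prod>i' = 0..<N. R i $$ (i', p i'))"
        using i p by (simp add: R_def)
    qed
  qed
  also have "\<dots> = (\<Sum>i\<in>{0..<N}. \<Sum>j<N. fps_deriv (M $$ (i, j)) * cofactor M i j)"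
  proof (intro sum.cong refl)
    fix i assume "i \<in> {0..<N}"
    then have i: "i < N" by simp
    have "cofactor (R i) i j = cofactor M i j" for j
    proof -
      \<comment> \<open>Row i is the only one in which \<open>R i\<close> and M differ.\<close>
      have "mat_delete (R i) i j = mat_delete M i j"
        using M by (intro eq_matI) (auto simp: mat_delete_def R_def)
      then show ?thesis by (simp add: cofactor_def)
    qed
    then show "det (R i) = (\<Sum>j<N. fps_deriv (M $$ (i, j)) * cofactor M i j)"
      unfolding laplace_expansion_row[OF R i] using i by (intro sum.cong) (auto simp: R_def)
  qed
  finally show ?thesis by (simp add: lessThan_atLeast0)
qed

text \<open>The derivative of I - yA is -A and the cofactors are det M times the entries of the
  resolvent H, so Jacobi's formula gives -(det M) tr(A H). The factor y turns the n-th coefficient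
  of tr(A H) into that of index n + 1, which is the trace of the power n + 1.\<close>

lemma log_deriv_det_char_series_mat:
  assumes A: "A \<in> carrier_mat N N"
  shows "- fps_X * fps_deriv (det (char_series_mat N A)) * fps_inv1 (det (char_series_mat N A)) =
    series_from_1 (\<lambda>n. \<Sum>i<N. (A ^\<^sub>m n) $$ (i, i))"
proof -
  let ?M = "char_series_mat N A"
  let ?H = "\<lambda>i j. Abs_fps (\<lambda>n. (A ^\<^sub>m n) $$ (i, j))"
  have M: "?M \<in> carrier_mat N N" by (rule char_series_mat_carrier[OF A])
  have "fps_deriv (det ?M) = (\<Sum>i<N. \<Sum>j<N. - (fps_const (A $$ (i, j)) * (det ?M * ?H j i)))"
    unfolding fps_deriv_det[OF M]
  proof (intro sum.cong refl)
    fix i j assume "i \<in> {..<N}" "j \<in> {..<N}"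
    then have ij: "i < N" "j < N" by auto
    then have "fps_deriv (?M $$ (i, j)) = - fps_const (A $$ (i, j))"
      using A by (simp add: char_series_mat_def)
    then show "fps_deriv (?M $$ (i, j)) * cofactor ?M i j =
        - (fps_const (A $$ (i, j)) * (det ?M * ?H j i))"
      unfolding cofactor_char_series_mat[OF A ij(2,1)] by (simp del: fps_const_neg)
  qed
  also have "\<dots> = - (det ?M * (\<Sum>i<N. \<Sum>j<N. fps_const (A $$ (i, j)) * ?H j i))"
    by (simp add: sum_negf sum_distrib_left mult_ac)
  finally have d: "fps_deriv (det ?M) = - (det ?M * (\<Sum>i<N. \<Sum>j<N. fps_const (A $$ (i, j)) * ?H j i))" .
  have "- fps_X * fps_deriv (det ?M) * fps_inv1 (det ?M) =
      fps_X * (\<Sum>i<N. \<Sum>j<N. fps_const (A $$ (i, j)) * ?H j i) * (det ?M * fps_inv1 (det ?M))"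
    unfolding d by (simp add: mult_ac)
  also have "\<dots> = fps_X * (\<Sum>i<N. \<Sum>j<N. fps_const (A $$ (i, j)) * ?H j i)"
    by (simp add: fps_inv1[OF det_char_series_mat_nth_0[OF A]])
  also have "\<dots> = series_from_1 (\<lambda>n. \<Sum>i<N. (A ^\<^sub>m n) $$ (i, i))"
  proof (rule fps_ext)
    fix n
    show "fps_nth (fps_X * (\<Sum>i<N. \<Sum>j<N. fps_const (A $$ (i, j)) * ?H j i)) n =
      fps_nth (series_from_1 (\<lambda>n. \<Sum>i<N. (A ^\<^sub>m n) $$ (i, i))) n"
    proof (cases n)
      case (Suc m)
      have "(A ^\<^sub>m Suc m) $$ (i, i) = (\<Sum>j<N. A $$ (i, j) * (A ^\<^sub>m m) $$ (j, i))" if "i < N" for i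
        unfolding pow_mat_Suc_left[OF A] using that A
        by (simp add: times_mat_def scalar_prod_def lessThan_atLeast0)
      then show ?thesis
        using Suc by (simp add: series_from_1_def fps_sum_nth del: pow_mat.simps)
    qed (simp add: series_from_1_def)
  qed
  finally show ?thesis .
qed

subsection \<open>Rook placements\<close>

fun ffact :: "nat \<Rightarrow> nat \<Rightarrow> nat" where
  "ffact n 0 = 1"
| "ffact n (Suc m) = n * ffact (n - 1) m"

lemma ffact_eq: "ffact n m = fact m * (n choose m)"
proof (induction m arbitrary: n)
  case (Suc m)
  show ?case
  proof (cases n)
    case Suc_n: (Suc n')
    have "ffact n (Suc m) = fact m * (Suc n' * (n' choose m))"
      using Suc_n Suc.IH[of n'] by (simp add: mult_ac del: mult_Suc)
    also have "\<dots> = fact m * (Suc m * (Suc n' choose Suc m))"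
      by (simp only: Suc_times_binomial)
    also have "\<dots> = fact (Suc m) * (n choose Suc m)"
      using Suc_n by (simp only: fact_Suc of_nat_id mult_ac)
    finally show ?thesis .
  qed simp
qed simp

text \<open>The telescoping rule for the circulant count. If a exceeds n both sides vanish, so
  truncated subtraction does no harm.\<close>

lemma ffact_add: "ffact n (a + b) = ffact n a * ffact (n - a) b"
proof (induction a arbitrary: n)
  case (Suc a)
  then show ?case by simp
qed simp

text \<open>Injections of m objects into n + 1 places: either the extra place stays empty, or one of
  the m objects sits there. \<open>rook_op_block\<close> needs this when a row is added to a
  block.\<close>

lemma ffact_Suc_left: "ffact (Suc n) m = ffact n m + m * ffact n (m - 1)"
proof (cases m)
  case (Suc m')
  have "ffact n (Suc m') = ffact n m' * (n - m')"
    using ffact_add[of n m' 1] by simp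
  \<comment> \<open>Here n - m' is truncated to 0; the vanishing factor makes up for it.\<close>
  moreover have "ffact n m' = 0" if "n < m'"
    using that by (simp add: ffact_eq binomial_eq_0)
  ultimately show ?thesis
    using Suc by (cases "n < m'") (auto simp: algebra_simps simp flip: distrib_left)
qed simp

lemma ffact_eq_0: "n < m \<Longrightarrow> ffact n m = 0"
  by (simp add: ffact_eq binomial_eq_0)

section \<open>Sums over rook placements and the rook polynomial\<close>

definition rook_gen :: "'r set \<Rightarrow> 'c set \<Rightarrow> ('r \<Rightarrow> 'c \<Rightarrow> 'b::comm_ring_1) \<Rightarrow> 'b" where
  "rook_gen R C w = (\<Sum>S\<in>Pow R. \<Sum>\<sigma> | \<sigma> \<in> S \<rightarrow>\<^sub>E C \<and> inj_on \<sigma> S. \<Prod>i\<in>S. w i (\<sigma> i))"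

lemma rook_gen_empty [simp]: "rook_gen {} C w = 1"
proof -
  have "{\<sigma>. \<sigma> \<in> {} \<rightarrow>\<^sub>E C \<and> inj_on \<sigma> {}} = {\<lambda>_. undefined}"
    by auto
  then show ?thesis by (simp add: rook_gen_def)
qed

lemma rook_gen_insert:
  assumes R: "finite R" "x \<notin> R" and C: "finite C"
  shows "rook_gen (insert x R) C w = rook_gen R C w + (\<Sum>c\<in>C. w x c * rook_gen R (C - {c}) w)"
proof -
  let ?I = "\<lambda>S C. {\<sigma>. \<sigma> \<in> S \<rightarrow>\<^sub>E C \<and> inj_on \<sigma> S}"
  let ?P = "\<lambda>S \<sigma>. \<Prod>i\<in>S. w i (\<sigma> i)"
  \<comment> \<open>An injection on \<open>insert x S\<close> amounts to a column c for x and an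
    injection of S into the remaining columns.\<close>
  have ext: "(\<Sum>\<sigma>\<in>?I (insert x S) C. ?P (insert x S) \<sigma>) = (\<Sum>c\<in>C. w x c * (\<Sum>\<sigma>\<in>?I S (C - {c}). ?P S \<sigma>))"
    if S: "S \<subseteq> R" for S
  proof -
    have x: "x \<notin> S" and finS: "finite S"
      using S R finite_subset by auto
    have set: "{(y, g). y \<in> C \<and> g \<in> S \<rightarrow>\<^sub>E (C - {y}) \<and> inj_on g S} = Sigma C (\<lambda>c. ?I S (C - {c}))"
      by auto
    have fin: "finite (?I S (C - {c}))" for c
      using finS C by (intro finite_subset[OF _ finite_PiE[of S "\<lambda>_. C"]]) (auto simp: PiE_def Pi_def)
    have "(\<Sum>\<sigma>\<in>?I (insert x S) C. ?P (insert x S) \<sigma>) =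
          (\<Sum>(c, \<sigma>)\<in>Sigma C (\<lambda>c. ?I S (C - {c})). ?P (insert x S) (\<sigma>(x := c)))"
      unfolding extensional_funcset_extend_domain_inj_on_eq[OF x] set[symmetric]
      by (subst sum.reindex[OF extensional_funcset_extend_domain_inj_onI[OF x]])
         (auto intro!: sum.cong)
    also have "\<dots> = (\<Sum>c\<in>C. \<Sum>\<sigma>\<in>?I S (C - {c}). ?P (insert x S) (\<sigma>(x := c)))"
      using C fin by (intro sum.Sigma[symmetric]) auto
    also have "\<dots> = (\<Sum>c\<in>C. w x c * (\<Sum>\<sigma>\<in>?I S (C - {c}). ?P S \<sigma>))"
      unfolding sum_distrib_left
    proof (intro sum.cong refl)
      fix c \<sigma>
      have "(\<Prod>i\<in>S. w i ((\<sigma>(x := c)) i)) = ?P S \<sigma>"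
        using x by (intro prod.cong) auto
      then show "?P (insert x S) (\<sigma>(x := c)) = w x c * ?P S \<sigma>"
        using finS x by simp
    qed
    finally show ?thesis .
  qed
  have "rook_gen (insert x R) C w =
      rook_gen R C w + (\<Sum>S\<in>insert x ` Pow R. \<Sum>\<sigma>\<in>?I S C. ?P S \<sigma>)"
    unfolding rook_gen_def Pow_insert using R
    by (intro sum.union_disjoint) auto
  also have "(\<Sum>S\<in>insert x ` Pow R. \<Sum>\<sigma>\<in>?I S C. ?P S \<sigma>) =
      (\<Sum>S\<in>Pow R. \<Sum>\<sigma>\<in>?I (insert x S) C. ?P (insert x S) \<sigma>)"
  proof (subst sum.reindex)
    show "inj_on (insert x) (Pow R)"
      using R(2) by (intro inj_onI) (metis PowD insert_ident subsetD)
  qed simp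
  also have "\<dots> = (\<Sum>S\<in>Pow R. \<Sum>c\<in>C. w x c * (\<Sum>\<sigma>\<in>?I S (C - {c}). ?P S \<sigma>))"
    using ext by (intro sum.cong refl) auto
  also have "\<dots> = (\<Sum>c\<in>C. w x c * rook_gen R (C - {c}) w)"
    unfolding rook_gen_def sum_distrib_left by (rule sum.swap)
  finally show ?thesis .
qed

lemma prod_monom: "(\<Prod>i\<in>S. monom (f i) 1) = monom (\<Prod>i\<in>S. f i) (card S)"
  for f :: "'i \<Rightarrow> 'a::comm_ring_1"
  by (induction S rule: infinite_finite_induct) (auto simp: mult_monom one_pCons monom_0)

text \<open>Every rook carries its own factor x, so a placement on S contributes the power of x with
  exponent \<open>card S\<close>. Grouping the sets S by size recovers the graded
  definition.\<close>

lemma rook_poly_eq_rook_gen: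
  "rook_poly A = rook_gen {0..<dim_row A} {0..<dim_col A} (\<lambda>i j. monom (A $$ (i, j)) 1)"
proof -
  let ?N = "dim_row A" and ?R = "{0..<dim_row A}"
  let ?g = "\<lambda>S. \<Sum>\<sigma> | \<sigma> \<in> S \<rightarrow>\<^sub>E {0..<dim_col A} \<and> inj_on \<sigma> S. monom (\<Prod>i\<in>S. A $$ (i, \<sigma> i)) (card S)"
  have "rook_gen ?R {0..<dim_col A} (\<lambda>i j. monom (A $$ (i, j)) 1) = (\<Sum>S\<in>Pow ?R. ?g S)"
    by (simp only: rook_gen_def prod_monom)
  also have "\<dots> = (\<Sum>j\<in>{0..?N}. \<Sum>S | S \<in> Pow ?R \<and> card S = j. ?g S)"
    by (intro sum.group[symmetric]) (auto dest: subset_eq_atLeast0_lessThan_card)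
  also have "\<dots> = (\<Sum>S | S \<in> Pow ?R \<and> card S = 0. ?g S) + (\<Sum>j\<in>{1..?N}. \<Sum>S | S \<in> Pow ?R \<and> card S = j. ?g S)"
    by (simp add: sum.atLeast_Suc_atMost)
  also have "{S. S \<in> Pow ?R \<and> card S = 0} = {{}}"
    by (auto dest: finite_subset)
  also have "(\<Sum>S\<in>{{}}. ?g S) = 1"
  proof -
    have "{\<sigma>. \<sigma> \<in> {} \<rightarrow>\<^sub>E {0..<dim_col A} \<and> inj_on \<sigma> {}} = {\<lambda>_. undefined}"
      by auto
    then show ?thesis by simp
  qed
  also have "(\<Sum>j\<in>{1..?N}. \<Sum>S | S \<in> Pow ?R \<and> card S = j. ?g S) = (\<Sum>j = 1..?N.
     monom (\<Sum>S | S \<subseteq> ?R \<and> card S = j.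
              \<Sum>\<sigma> | \<sigma> \<in> S \<rightarrow>\<^sub>E {0..<dim_col A} \<and> inj_on \<sigma> S. \<Prod>i\<in>S. A $$ (i, \<sigma> i)) j)"
    by (auto simp: monom_sum intro!: sum.cong)
  finally show ?thesis by (simp add: rook_poly_def)
qed

text \<open>Only the set of all rows reaches the top degree, and injective self-maps of a finite set
  are permutations.\<close>

lemma coeff_rook_poly_top:
  assumes "dim_col A = dim_row A"
  shows "coeff (rook_poly A) (dim_row A) = per A"
proof -
  let ?R = "{0..<dim_row A}"
  let ?h = "\<lambda>S. \<Sum>\<sigma> | \<sigma> \<in> S \<rightarrow>\<^sub>E ?R \<and> inj_on \<sigma> S. \<Prod>i\<in>S. A $$ (i, \<sigma> i)"
  have "coeff (rook_poly A) (dim_row A) = (\<Sum>S\<in>Pow ?R. if card S = dim_row A then ?h S else 0)"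
    unfolding rook_poly_eq_rook_gen rook_gen_def assms prod_monom coeff_sum coeff_monom
    by (intro sum.cong) auto
  also have "\<dots> = (\<Sum>S\<in>{?R}. ?h S)"
  proof (intro sum.mono_neutral_cong_right)
    show "\<forall>S\<in>Pow ?R - {?R}. (if card S = dim_row A then ?h S else 0) = 0"
      using card_subset_eq[of ?R] by auto
  qed auto
  also have "\<dots> = per A"
    unfolding per_def
  proof -
    have "?h ?R = (\<Sum>p | p permutes ?R. \<Prod>i = 0..<dim_row A. A $$ (i, p i))"
    \<comment> \<open>Outside \<open>?R\<close> an element of the function space is
      \<open>undefined\<close>, a permutation is the identity; the two witnesses exchange these
      conventions.\<close>
    proof (rule sum.reindex_bij_witness[where i = "\<lambda>p. restrict p ?R" and j = "\<lambda>\<sigma> i. if i \<in> ?R then \<sigma> i else i"])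
      fix \<sigma> assume s: "\<sigma> \<in> {\<sigma>. \<sigma> \<in> ?R \<rightarrow>\<^sub>E ?R \<and> inj_on \<sigma> ?R}"
      then show "restrict (\<lambda>i. if i \<in> ?R then \<sigma> i else i) ?R = \<sigma>"
        by (auto simp: fun_eq_iff PiE_def extensional_def)
      have "\<sigma> ` ?R = ?R"
        using s by (intro endo_inj_surj) auto
      then have "bij_betw \<sigma> ?R ?R"
        using s by (auto simp: bij_betw_def)
      then have "bij_betw (\<lambda>i. if i \<in> ?R then \<sigma> i else i) ?R ?R"
        by (subst bij_betw_cong[of ?R _ \<sigma>]) auto
      then show "(\<lambda>i. if i \<in> ?R then \<sigma> i else i) \<in> {p. p permutes ?R}"
        by (auto intro!: bij_imp_permutes)
    next
      fix p assume "p \<in> {p. p permutes ?R}"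
      then have p: "p permutes ?R" by simp
      then show "(\<lambda>i. if i \<in> ?R then restrict p ?R i else i) = p"
        by (auto simp: fun_eq_iff permutes_def)
      show "restrict p ?R \<in> {\<sigma>. \<sigma> \<in> ?R \<rightarrow>\<^sub>E ?R \<and> inj_on \<sigma> ?R}"
        using p permutes_in_image[OF p] permutes_inj[OF p] by (auto simp: inj_on_def inj_def)
    qed (auto intro!: prod.cong)
    then show "sum ?h {?R} = (\<Sum>p | p permutes ?R. \<Prod>i = 0..<dim_row A. A $$ (i, p i))"
      by simp
  qed
  finally show ?thesis .
qed

text \<open>Row \<open>i\<close> may place a rook in any of the \<open>f e\<close> free columns of class \<open>e\<close>, with weight \<open>u i e\<close>; \<open>E\<close> is
  applied to the numbers of columns that are free at the end.\<close>

fun rook_op :: "'e set \<Rightarrow> (nat \<Rightarrow> 'e \<Rightarrow> 'b::comm_ring_1) \<Rightarrow> (('e \<Rightarrow> nat) \<Rightarrow> 'b) \<Rightarrow> nat \<Rightarrow> ('e \<Rightarrow> nat) \<Rightarrow> 'b" where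
  "rook_op C u E 0 f = E f"
| "rook_op C u E (Suc N) f =
     rook_op C u E N f + (\<Sum>e\<in>C. u N e * of_nat (f e) * rook_op C u E N (f(e := f e - 1)))"

text \<open>The weight of a column depends on its class only. The \<open>f e\<close> free columns of
  class e therefore give equal terms, and occupying one of them lowers just that count.\<close>

lemma rook_gen_eq_rook_op:
  assumes "finite J" "finite C" "\<pi> ` C \<subseteq> J"
    and "\<And>i c. i < N \<Longrightarrow> c \<in> C \<Longrightarrow> w i c = u i (\<pi> c)"
  shows "rook_gen {0..<N} C w = rook_op J u (\<lambda>_. 1) N (\<lambda>e. card {c \<in> C. \<pi> c = e})"
  using assms(2-)
proof (induction N arbitrary: C)
  case 0
  then show ?case by simp
next
  case (Suc N)
  let ?f = "\<lambda>e. card {c \<in> C. \<pi> c = e}"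
  have step: "w N c * rook_gen {0..<N} (C - {c}) w =
     u N (\<pi> c) * rook_op J u (\<lambda>_. 1) N (?f(\<pi> c := ?f (\<pi> c) - 1))" if c: "c \<in> C" for c
  proof -
    have "{c' \<in> C - {c}. \<pi> c' = e} = (if e = \<pi> c then {c' \<in> C. \<pi> c' = e} - {c} else {c' \<in> C. \<pi> c' = e})" for e
      by auto
    then have "(\<lambda>e. card {c' \<in> C - {c}. \<pi> c' = e}) = ?f(\<pi> c := ?f (\<pi> c) - 1)"
      using c Suc.prems(1) by (auto simp: fun_eq_iff card_Diff_singleton)
    moreover have "rook_gen {0..<N} (C - {c}) w =
        rook_op J u (\<lambda>_. 1) N (\<lambda>e. card {c' \<in> C - {c}. \<pi> c' = e})"
      using Suc.prems by (intro Suc.IH) auto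
    ultimately show ?thesis using Suc.prems c by simp
  qed
  let ?g = "\<lambda>e. u N e * rook_op J u (\<lambda>_. 1) N (?f(e := ?f e - 1))"
  have "rook_gen {0..<Suc N} C w = rook_gen {0..<N} C w + (\<Sum>c\<in>C. w N c * rook_gen {0..<N} (C - {c}) w)"
    using rook_gen_insert[of "{0..<N}" N C w] Suc.prems(1) by (simp add: atLeast0_lessThan_Suc)
  also have "rook_gen {0..<N} C w = rook_op J u (\<lambda>_. 1) N ?f"
    using Suc.prems by (intro Suc.IH) auto
  also have "(\<Sum>c\<in>C. w N c * rook_gen {0..<N} (C - {c}) w) = (\<Sum>c\<in>C. ?g (\<pi> c))"
    using step by (intro sum.cong) auto
  also have "\<dots> = (\<Sum>e\<in>J. \<Sum>c | c \<in> C \<and> \<pi> c = e. ?g (\<pi> c))"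
    using Suc.prems assms(1) by (intro sum.group[symmetric]) auto
  also have "\<dots> = (\<Sum>e\<in>J. u N e * of_nat (?f e) * rook_op J u (\<lambda>_. 1) N (?f(e := ?f e - 1)))"
    by (intro sum.cong) (auto simp: mult_ac)
  finally show ?case by simp
qed

lemma card_div_eq:
  assumes "1 \<le> k"
  shows "card {c \<in> {0..<n * k}. c div k = J} = (if J < n then k else 0)"
proof (cases "J < n")
  case True
  have "{c \<in> {0..<n * k}. c div k = J} = {J * k..<J * k + k}"
  proof (intro equalityI subsetI)
    fix c assume "c \<in> {c \<in> {0..<n * k}. c div k = J}"
    then show "c \<in> {J * k..<J * k + k}"
      using assms div_mult_mod_eq[of c k] mod_less_divisor[of k c] by (auto simp del: mod_less_divisor)
  next
    fix c assume c: "c \<in> {J * k..<J * k + k}"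
    have "J * k + k \<le> n * k"
      using mult_le_mono1[of "Suc J" n k] True by simp
    moreover have "c div k = J"
      using c by (intro div_nat_eqI) (auto simp: mult.commute)
    ultimately show "c \<in> {c \<in> {0..<n * k}. c div k = J}"
      using c by auto
  qed
  then show ?thesis using True by simp
next
  case False
  then have "c div k \<noteq> J" if "c < n * k" for c
    using less_mult_imp_div_less[OF that] by auto
  then have "{c \<in> {0..<n * k}. c div k = J} = {}" by auto
  then show ?thesis using False by simp
qed

lemma rook_poly_kronecker_ones:
  assumes "1 \<le> k" and A: "A \<in> carrier_mat n n"
  shows "rook_poly (kronecker A (ones_mat k)) =
    rook_op {0..<n} (\<lambda>\<rho> J. monom (A $$ (\<rho> div k, J)) 1) (\<lambda>_. 1) (n * k) (\<lambda>J. if J < n then k else 0)"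
proof -
  let ?B = "kronecker A (ones_mat k)"
  have dim: "dim_row ?B = n * k" "dim_col ?B = n * k"
    using A by (simp_all add: kronecker_def ones_mat_def)
  have "rook_gen {0..<n * k} {0..<n * k} (\<lambda>i j. monom (?B $$ (i, j)) 1) =
    rook_op {0..<n} (\<lambda>\<rho> J. monom (A $$ (\<rho> div k, J)) 1) (\<lambda>_. 1) (n * k)
      (\<lambda>J. card {c \<in> {0..<n * k}. c div k = J})"
    using assms
    by (intro rook_gen_eq_rook_op)
       (auto simp: kronecker_def ones_mat_def less_mult_imp_div_less)
  then show ?thesis
    unfolding rook_poly_eq_rook_gen dim card_div_eq[OF \<open>1 \<le> k\<close>] .
qed

text \<open>The j rows are interchangeable. If \<open>q e\<close> rooks go to class e, the binomials
  choose the columns, and \<open>ffact j\<close> of the total counts the ways to give these columns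
  distinct rows.\<close>

lemma rook_op_block:
  assumes C: "finite C" and W: "W \<subseteq> C"
    and u: "\<And>\<rho> e. N \<le> \<rho> \<Longrightarrow> \<rho> < N + j \<Longrightarrow> e \<in> C \<Longrightarrow> u \<rho> e = (if e \<in> W then w e else 0)"
  shows "rook_op C u E (N + j) f =
    (\<Sum>q\<in>PiE W (\<lambda>e. {0..f e}).
       of_nat (ffact j (\<Sum>e\<in>W. q e) * (\<Prod>e\<in>W. f e choose q e)) * (\<Prod>e\<in>W. w e ^ q e) *
       rook_op C u E N (\<lambda>e. if e \<in> W then f e - q e else f e))"
  using u
proof (induction j arbitrary: f)
  case 0
  have finW: "finite W" using C W finite_subset by auto
  let ?z = "restrict (\<lambda>_. 0) W :: 'a \<Rightarrow> nat"
  let ?F = "\<lambda>q. of_nat (ffact 0 (\<Sum>e\<in>W. q e) * (\<Prod>e\<in>W. f e choose q e)) * (\<Prod>e\<in>W. w e ^ q e) *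
       rook_op C u E N (\<lambda>e. if e \<in> W then f e - q e else f e)"
  have "(\<Sum>q\<in>PiE W (\<lambda>e. {0..f e}). ?F q) = (\<Sum>q\<in>{?z}. ?F q)"
  proof (intro sum.mono_neutral_right)
    show "\<forall>q\<in>PiE W (\<lambda>e. {0..f e}) - {?z}. ?F q = 0"
    proof
      fix q assume q: "q \<in> PiE W (\<lambda>e. {0..f e}) - {?z}"
      have "\<exists>e\<in>W. q e \<noteq> 0"
      proof (rule ccontr)
        assume "\<not> (\<exists>e\<in>W. q e \<noteq> 0)"
        then have "q = ?z"
          using q by (intro ext) (auto simp: PiE_def extensional_def)
        then show False using q by simp
      qed
      then have "0 < (\<Sum>e\<in>W. q e)"
        using finW sum_pos2[of W _ q] by auto
      then show "?F q = 0" by (simp only: ffact_eq_0) simp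
    qed
  qed (use finW in \<open>auto intro!: finite_PiE\<close>)
  also have "\<dots> = rook_op C u E N f"
  proof -
    have "(\<lambda>e. if e \<in> W then f e - ?z e else f e) = f"
      by auto
    then show ?thesis by simp
  qed
  finally show ?case by simp
next
  case (Suc j)
  have finW: "finite W" using C W finite_subset by auto
  let ?Y = "\<lambda>f q. rook_op C u E N (\<lambda>e. if e \<in> W then f e - q e else f e)"
  let ?b = "\<lambda>f q. \<Prod>e\<in>W. (f e choose q e)" and ?w = "\<lambda>q. \<Prod>e\<in>W. w e ^ q e"
  let ?P = "\<lambda>f. PiE W (\<lambda>e. {0..f e::nat})"
  have IH: "rook_op C u E (N + j) f =
     (\<Sum>q\<in>?P f. of_nat (ffact j (sum q W) * ?b f q) * ?w q * ?Y f q)" for f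
    using Suc.prems by (intro Suc.IH) auto
  \<comment> \<open>Here \<open>q\<close> counts the rook of the new row too. The identity f (f-1
    choose q-1) = q (f choose q) says that this rook takes one of the \<open>q e\<close> chosen
    columns of class e.\<close>
  have part: "w e * of_nat (f e) * rook_op C u E (N + j) (f(e := f e - 1)) =
      (\<Sum>q\<in>?P f. of_nat (q e * ffact j (sum q W - 1) * ?b f q) * ?w q * ?Y f q)" (is "?lhs = ?rhs")
    if e: "e \<in> W" for e
  proof (cases "f e = 0")
    case True
    have "of_nat (q e * ffact j (sum q W - 1) * ?b f q) * ?w q * ?Y f q = 0" if "q \<in> ?P f" for q
    proof -
      have "q e = 0" using True that PiE_mem[OF that e] by simp
      then show ?thesis by simp
    qed
    then have "?rhs = 0" by (intro sum.neutral ballI)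
    then show ?thesis using True by simp
  next
    case False
    let ?f = "f(e := f e - 1)"
    have "?rhs = (\<Sum>q | q \<in> ?P f \<and> 1 \<le> q e. of_nat (q e * ffact j (sum q W - 1) * ?b f q) * ?w q * ?Y f q)"
    proof (intro sum.mono_neutral_right)
      show "\<forall>q\<in>?P f - {q. q \<in> ?P f \<and> 1 \<le> q e}.
        of_nat (q e * ffact j (sum q W - 1) * ?b f q) * ?w q * ?Y f q = 0"
        by (auto simp: not_le)
    qed (use finW in \<open>auto intro!: finite_PiE\<close>)
    also have "\<dots> = (\<Sum>q\<in>?P ?f. w e * of_nat (f e) * (of_nat (ffact j (sum q W) * ?b ?f q) * ?w q * ?Y ?f q))"
    proof (rule sum.reindex_bij_witness[where i = "\<lambda>q. q(e := Suc (q e))" and j = "\<lambda>q. q(e := q e - 1)"])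
      fix q assume q: "q \<in> {q. q \<in> ?P f \<and> 1 \<le> q e}"
      let ?q = "q(e := q e - 1)"
      show "?q(e := Suc (?q e)) = q" using q by auto
      show "?q \<in> ?P ?f"
        using q e by (auto simp: PiE_def Pi_def extensional_def)
      have sum: "sum ?q W = sum q W - 1"
      proof -
        have "sum ?q (W - {e}) = sum q (W - {e})" by (intro sum.cong) auto
        then show ?thesis using q e finW by (simp add: sum.remove[of W e])
      qed
      have b: "f e * ?b ?f ?q = q e * ?b f q"
      proof -
        have "(\<Prod>x\<in>W - {e}. ?f x choose ?q x) = (\<Prod>x\<in>W - {e}. f x choose q x)"
          by (intro prod.cong) auto
        moreover have "f e * ((f e - 1) choose (q e - 1)) = q e * (f e choose q e)"
          using times_binomial_minus1_eq[of "q e" "f e"] q by simp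
        ultimately show ?thesis
          using e finW by (simp add: prod.remove[of W e] algebra_simps)
      qed
      have w: "?w q = w e * ?w ?q"
      proof -
        have "(\<Prod>x\<in>W - {e}. w x ^ ?q x) = (\<Prod>x\<in>W - {e}. w x ^ q x)"
          by (intro prod.cong) auto
        moreover have "w e ^ q e = w e * w e ^ (q e - 1)"
          using q by (simp add: power_eq_if)
        ultimately show ?thesis
          using e finW by (simp add: prod.remove[of W e] algebra_simps)
      qed
      have Y: "?Y ?f ?q = ?Y f q"
        using q e by (intro arg_cong[where f = "rook_op C u E N"]) (auto simp: fun_eq_iff)
      have "w e * of_nat (f e) * (of_nat (ffact j (sum ?q W) * ?b ?f ?q) * ?w ?q * ?Y ?f ?q) =
         of_nat (ffact j (sum ?q W)) * of_nat (f e * ?b ?f ?q) * (w e * ?w ?q) * ?Y ?f ?q"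
        by (simp only: of_nat_mult mult_ac)
      also have "\<dots> = of_nat (q e * ffact j (sum q W - 1) * ?b f q) * ?w q * ?Y f q"
        unfolding b sum Y w[symmetric] by (simp only: of_nat_mult mult_ac)
      finally show "w e * of_nat (f e) * (of_nat (ffact j (sum ?q W) * ?b ?f ?q) * ?w ?q * ?Y ?f ?q) =
         of_nat (q e * ffact j (sum q W - 1) * ?b f q) * ?w q * ?Y f q" .
    next
      fix q assume q: "q \<in> ?P ?f"
      show "(q(e := Suc (q e)))(e := (q(e := Suc (q e))) e - 1) = q" by auto
      have "q e \<le> f e - 1" using q e by (auto simp: PiE_def Pi_def)
      then show "q(e := Suc (q e)) \<in> {q. q \<in> ?P f \<and> 1 \<le> q e}"
        using q e False by (auto simp: PiE_def Pi_def extensional_def split: if_splits)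
    qed
    finally show ?thesis
      unfolding IH sum_distrib_left by simp
  qed
  have "(\<Sum>e\<in>C. u (N + j) e * of_nat (f e) * rook_op C u E (N + j) (f(e := f e - 1))) =
        (\<Sum>e\<in>W. w e * of_nat (f e) * rook_op C u E (N + j) (f(e := f e - 1)))"
    using C W Suc.prems[of "N + j"] by (intro sum.mono_neutral_cong_right) auto
  also have "\<dots> = (\<Sum>e\<in>W. \<Sum>q\<in>?P f. of_nat (q e * ffact j (sum q W - 1) * ?b f q) * ?w q * ?Y f q)"
    using part by (intro sum.cong refl) auto
  also have "\<dots> = (\<Sum>q\<in>?P f. \<Sum>e\<in>W. of_nat (q e * ffact j (sum q W - 1) * ?b f q) * ?w q * ?Y f q)"
    by (rule sum.swap)
  \<comment> \<open>Over all classes the new row may hold any one of the \<open>sum q W\<close>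
    rooks. With the case of an empty new row this is the recursion
    \<open>ffact_Suc_left\<close>.\<close>
  also have "\<dots> = (\<Sum>q\<in>?P f. of_nat (sum q W * ffact j (sum q W - 1) * ?b f q) * ?w q * ?Y f q)"
    by (intro sum.cong refl) (simp flip: sum_distrib_right of_nat_sum)
  finally have "rook_op C u E (N + Suc j) f =
     (\<Sum>q\<in>?P f. of_nat (ffact j (sum q W) * ?b f q) * ?w q * ?Y f q) +
     (\<Sum>q\<in>?P f. of_nat (sum q W * ffact j (sum q W - 1) * ?b f q) * ?w q * ?Y f q)"
    using IH[of f] by simp
  also have "\<dots> = (\<Sum>q\<in>?P f. of_nat (ffact (Suc j) (sum q W) * ?b f q) * ?w q * ?Y f q)"
    unfolding ffact_Suc_left by (simp add: algebra_simps flip: sum.distrib)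
  finally show ?case .
qed

text \<open>Here only the number of rooks in each class is recorded, and \<open>\<Phi>\<close> of these numbers is summed. Column
  capacities enter only through \<open>\<Phi>\<close>, so that classes sharing their columns can be merged.\<close>

fun usage_op :: "'e set \<Rightarrow> (nat \<Rightarrow> 'e \<Rightarrow> 'b::comm_ring_1) \<Rightarrow> nat \<Rightarrow> (('e \<Rightarrow> nat) \<Rightarrow> 'b) \<Rightarrow> 'b" where
  "usage_op C u 0 \<Phi> = \<Phi> (\<lambda>_. 0)"
| "usage_op C u (Suc N) \<Phi> =
     usage_op C u N \<Phi> + (\<Sum>e\<in>C. u N e * usage_op C u N (\<lambda>m. \<Phi> (m(e := Suc (m e)))))"

lemma usage_op_scale: "usage_op C u N (\<lambda>m. c * \<Phi> m) = c * usage_op C u N \<Phi>"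
  by (induction N arbitrary: \<Phi>) (auto simp: sum_distrib_left algebra_simps)

lemma usage_op_sum: "usage_op C u N (\<lambda>m. \<Sum>\<alpha>\<in>S. \<Phi> \<alpha> m) = (\<Sum>\<alpha>\<in>S. usage_op C u N (\<Phi> \<alpha>))"
proof (induction N arbitrary: \<Phi>)
  case (Suc N)
  have "(\<Sum>e\<in>C. u N e * (\<Sum>\<alpha>\<in>S. usage_op C u N (\<lambda>m. \<Phi> \<alpha> (m(e := Suc (m e)))))) =
    (\<Sum>\<alpha>\<in>S. \<Sum>e\<in>C. u N e * usage_op C u N (\<lambda>m. \<Phi> \<alpha> (m(e := Suc (m e)))))"
    unfolding sum_distrib_left by (rule sum.swap)
  then show ?case by (simp add: Suc sum.distrib)
qed simp

text \<open>Successive rooks in a class meet the factors f, f - 1, and so on, whichever rows they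
  come from; their product is a falling factorial. Where usage exceeds capacity this product is 0,
  so the truncated differences passed to \<open>E\<close> are harmless.\<close>

lemma rook_op_eq_usage_op:
  assumes C: "finite C"
  shows "rook_op C u E N f =
    usage_op C u N (\<lambda>m. of_nat (\<Prod>e\<in>C. ffact (f e) (m e)) * E (\<lambda>e. f e - m e))"
proof (induction N arbitrary: f)
  case (Suc N)
  have step: "of_nat (f e) * rook_op C u E N (f(e := f e - 1)) =
    usage_op C u N (\<lambda>m. of_nat (\<Prod>x\<in>C. ffact (f x) ((m(e := Suc (m e))) x)) *
       E (\<lambda>x. f x - (m(e := Suc (m e))) x))" if e: "e \<in> C" for e
  proof -
    let ?f = "f(e := f e - 1)"
    have "of_nat (f e) * (of_nat (\<Prod>x\<in>C. ffact (?f x) (m x)) * E (\<lambda>x. ?f x - m x)) =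
      of_nat (\<Prod>x\<in>C. ffact (f x) ((m(e := Suc (m e))) x)) * E (\<lambda>x. f x - (m(e := Suc (m e))) x)" for m
    proof -
      have "(\<Prod>x\<in>C - {e}. ffact (?f x) (m x)) = (\<Prod>x\<in>C - {e}. ffact (f x) ((m(e := Suc (m e))) x))"
        by (intro prod.cong) auto
      then have "f e * (\<Prod>x\<in>C. ffact (?f x) (m x)) = (\<Prod>x\<in>C. ffact (f x) ((m(e := Suc (m e))) x))"
        using C e by (simp add: prod.remove[of C e])
      moreover have "(\<lambda>x. ?f x - m x) = (\<lambda>x. f x - (m(e := Suc (m e))) x)"
        by (auto simp: fun_eq_iff)
      ultimately show ?thesis
        by (simp only: mult.assoc[symmetric] of_nat_mult[symmetric])
    qed
    then show ?thesis
      unfolding Suc.IH usage_op_scale[symmetric]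
      by (intro arg_cong[where f = "usage_op C u N"] ext)
  qed
  then show ?case using Suc.IH[of f] by (simp add: mult.assoc del: fun_upd_apply)
qed simp

text \<open>This carries a true matrix over to its cover by the band. The copies e of a class x
  share its \<open>f x\<close> columns, hence only their total usage enters the falling factorial.
  Classes outside \<open>C'\<close> have no counterpart in the matrix and must stay empty.\<close>

lemma rook_op_merge:
  fixes u :: "nat \<Rightarrow> 'e \<Rightarrow> 'b::comm_ring_1"
  assumes C: "finite C" and J: "finite J" and C': "C' \<subseteq> C" "\<pi> ` C' \<subseteq> J"
    and v: "\<And>i x. i < N \<Longrightarrow> x \<in> J \<Longrightarrow> v i x = (\<Sum>e | e \<in> C' \<and> \<pi> e = x. u i e)"
  shows "rook_op J v (\<lambda>_. 1) N f =
    usage_op C u N (\<lambda>m. of_nat (\<Prod>x\<in>J. ffact (f x) (\<Sum>e | e \<in> C' \<and> \<pi> e = x. m e)) *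
      (if \<forall>e\<in>C - C'. m e = 0 then 1 else 0))"
  using v
proof (induction N arbitrary: f)
  case 0
  then show ?case by simp
next
  case (Suc N)
  have finC': "finite C'" using C C' finite_subset by auto
  let ?\<Phi> = "\<lambda>f m. of_nat (\<Prod>x\<in>J. ffact (f x) (\<Sum>e | e \<in> C' \<and> \<pi> e = x. m e)) *
      (if \<forall>e\<in>C - C'. m e = 0 then 1 else 0) :: 'b"
  have IH: "rook_op J v (\<lambda>_. 1) N f = usage_op C u N (?\<Phi> f)" for f
    using Suc.prems by (intro Suc.IH) auto
  have step: "of_nat (f (\<pi> e)) * rook_op J v (\<lambda>_. 1) N (f(\<pi> e := f (\<pi> e) - 1)) =
      usage_op C u N (\<lambda>m. ?\<Phi> f (m(e := Suc (m e))))" if e: "e \<in> C'" for e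
  proof -
    let ?x = "\<pi> e" and ?f = "f(\<pi> e := f (\<pi> e) - 1)"
    have x: "?x \<in> J" using e C' by auto
    have "of_nat (f ?x) * ?\<Phi> ?f m = ?\<Phi> f (m(e := Suc (m e)))" for m
    proof -
      let ?m = "m(e := Suc (m e))"
      let ?s = "\<lambda>m x. \<Sum>e | e \<in> C' \<and> \<pi> e = x. m e"
      have other: "?s ?m x = ?s m x" if "x \<noteq> ?x" for x
        using that by (intro sum.cong) auto
      have "?s ?m ?x = Suc (?s m ?x)"
      proof -
        have "sum ?m ({a \<in> C'. \<pi> a = ?x} - {e}) = sum m ({a \<in> C'. \<pi> a = ?x} - {e})"
          by (intro sum.cong) auto
        then show ?thesis
          using e finC' by (simp add: sum.remove[of "{a \<in> C'. \<pi> a = ?x}" e])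
      qed
      moreover have "(\<Prod>x\<in>J - {?x}. ffact (?f x) (?s m x)) = (\<Prod>x\<in>J - {?x}. ffact (f x) (?s ?m x))"
        using other by (intro prod.cong) auto
      ultimately have "f ?x * (\<Prod>x\<in>J. ffact (?f x) (?s m x)) = (\<Prod>x\<in>J. ffact (f x) (?s ?m x))"
        using J x by (simp add: prod.remove[of J ?x])
      moreover have "(\<forall>e\<in>C - C'. m e = 0) = (\<forall>e\<in>C - C'. ?m e = 0)"
        using e by auto
      ultimately show ?thesis
        by (simp only: mult.assoc[symmetric] of_nat_mult[symmetric])
    qed
    then show ?thesis
      unfolding IH usage_op_scale[symmetric]
      by (intro arg_cong[where f = "usage_op C u N"] ext)
  qed
  have out: "usage_op C u N (\<lambda>m. ?\<Phi> f (m(e := Suc (m e)))) = 0" if e: "e \<in> C - C'" for e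
  proof -
    have "?\<Phi> f (m(e := Suc (m e))) = 0 * ?\<Phi> f m" for m
    proof -
      have "\<not> (\<forall>x\<in>C - C'. (m(e := Suc (m e))) x = 0)"
        using e by auto
      then show ?thesis by (simp only: if_False mult_zero_left mult_zero_right)
    qed
    then have "usage_op C u N (\<lambda>m. ?\<Phi> f (m(e := Suc (m e)))) = usage_op C u N (\<lambda>m. 0 * ?\<Phi> f m)"
      by (intro arg_cong[where f = "usage_op C u N"] ext)
    also have "\<dots> = 0" unfolding usage_op_scale by simp
    finally show ?thesis .
  qed
  let ?h = "\<lambda>x. of_nat (f x) * rook_op J v (\<lambda>_. 1) N (f(x := f x - 1))"
  have "(\<Sum>x\<in>J. v N x * ?h x) = (\<Sum>x\<in>J. \<Sum>e | e \<in> C' \<and> \<pi> e = x. u N e * ?h (\<pi> e))"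
    using Suc.prems by (intro sum.cong refl) (auto simp: sum_distrib_right)
  also have "\<dots> = (\<Sum>e\<in>C'. u N e * ?h (\<pi> e))"
    using finC' J C' by (intro sum.group) auto
  also have "\<dots> = (\<Sum>e\<in>C'. u N e * usage_op C u N (\<lambda>m. ?\<Phi> f (m(e := Suc (m e)))))"
    using step by (intro sum.cong) auto
  also have "\<dots> = (\<Sum>e\<in>C. u N e * usage_op C u N (\<lambda>m. ?\<Phi> f (m(e := Suc (m e)))))"
    using C C' out by (intro sum.mono_neutral_left) auto
  finally show ?case using IH[of f] by (simp add: mult.assoc del: fun_upd_apply)
qed

subsection \<open>The transfer matrix\<close>

lemma mult_seq_eq_iff: "mult_seq t l = mult_seq t l' \<longleftrightarrow> (\<forall>i\<in>{1..t}. l i = l' i)"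
proof
  assume "mult_seq t l = mult_seq t l'"
  then have "count_list (mult_seq t l) i = count_list (mult_seq t l') i" for i by simp
  then show "\<forall>i\<in>{1..t}. l i = l' i"
    unfolding count_mult_seq by (metis atLeastAtMost_iff)
next
  assume "\<forall>i\<in>{1..t}. l i = l' i"
  then show "mult_seq t l = mult_seq t l'"
    unfolding mult_seq_def by (intro arg_cong[where f = concat] map_cong) auto
qed

lemma mult_seq_count_list:
  assumes "\<alpha> \<in> G_set k t"
  shows "mult_seq t (count_list \<alpha>) = \<alpha>"
  using assms by (auto simp: G_set_def mult_seq_eq_iff count_mult_seq)

lemma count_list_G_set:
  assumes "\<alpha> \<in> G_set k t"
  shows "count_list \<alpha> i \<le> k" "i = 0 \<or> t < i \<Longrightarrow> count_list \<alpha> i = 0"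
  using assms by (auto simp: G_set_def count_mult_seq)

lemma mult_seq_in_G_set: "(\<And>i. 1 \<le> i \<Longrightarrow> i \<le> t \<Longrightarrow> l i \<le> k) \<Longrightarrow> mult_seq t l \<in> G_set k t"
  by (auto simp: G_set_def)

lemma G_set_eqI:
  assumes "\<alpha> \<in> G_set k t" "\<beta> \<in> G_set k t" "\<And>i. 1 \<le> i \<Longrightarrow> i \<le> t \<Longrightarrow> count_list \<alpha> i = count_list \<beta> i"
  shows "\<alpha> = \<beta>"
proof -
  have "mult_seq t (count_list \<alpha>) = mult_seq t (count_list \<beta>)"
    unfolding mult_seq_eq_iff using assms(3) by simp
  then show ?thesis
    using assms(1,2) by (simp add: mult_seq_count_list)
qed

lemma bij_betw_G_set: "bij_betw (mult_seq t) ({1..t} \<rightarrow>\<^sub>E {0..k}) (G_set k t)"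
proof (rule bij_betwI[where g = "\<lambda>\<alpha>. restrict (count_list \<alpha>) {1..t}"])
  show "mult_seq t \<in> ({1..t} \<rightarrow>\<^sub>E {0..k}) \<rightarrow> G_set k t"
    by (auto intro!: mult_seq_in_G_set simp: PiE_def Pi_def)
  show "(\<lambda>\<alpha>. restrict (count_list \<alpha>) {1..t}) \<in> G_set k t \<rightarrow> ({1..t} \<rightarrow>\<^sub>E {0..k})"
    by (auto simp: count_list_G_set)
next
  fix l assume "l \<in> {1..t} \<rightarrow>\<^sub>E {0..k}"
  then show "restrict (count_list (mult_seq t l)) {1..t} = l"
    by (auto simp: fun_eq_iff count_mult_seq PiE_def extensional_def)
next
  fix \<alpha> assume "\<alpha> \<in> G_set k t"
  then show "mult_seq t (restrict (count_list \<alpha>) {1..t}) = \<alpha>"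
    using mult_seq_count_list[of \<alpha> k t] mult_seq_eq_iff[of t "restrict (count_list \<alpha>) {1..t}" "count_list \<alpha>"]
    by simp
qed

lemma finite_G_set: "finite (G_set k t)"
  using bij_betw_finite[OF bij_betw_G_set[of t k]] by (simp add: finite_PiE)

lemma card_G_set: "card (G_set k t) = (k + 1) ^ t"
  using bij_betw_same_card[OF bij_betw_G_set[of t k]] by (simp add: card_PiE)

lemma sum_PiE_insert:
  assumes "x \<notin> S"
  shows "(\<Sum>q\<in>PiE (insert x S) T. g q) = (\<Sum>q\<in>PiE S T. \<Sum>d\<in>T x. g (q(x := d)))"
proof -
  have "(\<Sum>q\<in>PiE (insert x S) T. g q) = (\<Sum>(d, q)\<in>T x \<times> PiE S T. g (q(x := d)))"
    unfolding PiE_insert_eq using assms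
    by (subst sum.reindex[OF inj_combinator]) (auto intro!: sum.cong)
  also have "\<dots> = (\<Sum>d\<in>T x. \<Sum>q\<in>PiE S T. g (q(x := d)))"
    by (simp add: sum.cartesian_product)
  finally show ?thesis by (simp add: sum.swap[of _ "T x"])
qed

text \<open>This reads a row of K as one block row of rooks. Block s of the window has
  \<open>f s\<close> free columns, \<open>f 0 = k\<close> because block 0 has just entered, and
  receives \<open>q s\<close> rooks. In the formula for the entry, \<open>q i = p i\<close> for 0 <
  i < t, \<open>q t = d\<close>, and v is the number of rooks outside block t.\<close>

lemma sum_K_entry:
  fixes a :: "nat \<Rightarrow> 'b::comm_ring_1"
  assumes \<alpha>: "\<alpha> \<in> G_set k t"
  defines "f \<equiv> \<lambda>s. if s = 0 then k else count_list \<alpha> s"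
  shows "(\<Sum>\<beta>\<in>G_set k t. K_entry k t a \<alpha> \<beta> * X \<beta>) =
    (\<Sum>q\<in>PiE {0..t} (\<lambda>s. {0..f s}).
       of_nat (ffact k (\<Sum>s\<in>{0..t}. q s) * (\<Prod>s\<in>{0..t}. f s choose q s)) * (\<Prod>s\<in>{0..t}. a s ^ q s) *
       X (mult_seq t (\<lambda>j. f (j - 1) - q (j - 1))))"
proof (cases "t = 0")
  case True
  have G: "G_set k 0 = {[]}"
    by (auto simp: G_set_def mult_seq_def)
  have "(\<Sum>q\<in>PiE {0..0} (\<lambda>s. {0..f s}).
       of_nat (ffact k (\<Sum>s\<in>{0..0}. q s) * (\<Prod>s\<in>{0..0}. f s choose q s)) * (\<Prod>s\<in>{0..0}. a s ^ q s) *
       X (mult_seq 0 (\<lambda>j. f (j - 1) - q (j - 1)))) =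
     (\<Sum>d\<in>{0..k}. of_nat (ffact k d * (k choose d)) * a 0 ^ d * X [])"
    using sum_PiE_insert[of 0 "{}" "\<lambda>q. of_nat (ffact k (q 0)) * of_nat (k choose q 0) * a 0 ^ q 0 * X []" "\<lambda>s. {0..f s}"]
    by (simp add: f_def mult_seq_def)
  also have "\<dots> = K_entry k 0 a \<alpha> [] * X []"
    by (simp add: K_entry_def sum_distrib_left ffact_eq power2_eq_square mult_ac)
  finally show ?thesis using True G by simp
next
  case False
  then have t: "1 \<le> t" by simp
  have I: "{0..t} = insert t {0..<t}" "{0..<t} = insert 0 {1..<t}"
    using t by auto
  let ?P = "PiE {0..<t} (\<lambda>s. {0..f s})"
  let ?\<beta> = "\<lambda>q. shift_seq t \<alpha> (k - q 0) q"
  let ?v = "\<lambda>q. \<Sum>s\<in>{0..<t}. q s"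
  have v: "?v q = q 0 + (\<Sum>i = 1..<t. q i)" for q :: "nat \<Rightarrow> nat"
    unfolding I(2) by simp
  have \<beta>_eq: "mult_seq t (\<lambda>j. f (j - 1) - (q(t := d)) (j - 1)) = ?\<beta> q" for q d
    unfolding shift_seq_def mult_seq_eq_iff by (auto simp: f_def)
  \<comment> \<open>Block t leaves the window, so its usage d leaves no trace in the column index
    and is summed inside the entry.\<close>
  have inner: "(\<Sum>d\<in>{0..f t}. of_nat (ffact k (\<Sum>s\<in>{0..t}. (q(t := d)) s) * (\<Prod>s\<in>{0..t}. f s choose (q(t := d)) s)) *
       (\<Prod>s\<in>{0..t}. a s ^ (q(t := d)) s) * X (mult_seq t (\<lambda>j. f (j - 1) - (q(t := d)) (j - 1)))) =
     K_val k t a \<alpha> q (?v q) * X (?\<beta> q)" for q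
  proof -
    have s: "(\<Sum>s\<in>{0..t}. (q(t := d)) s) = d + ?v q" for d
      unfolding I(1) by simp
    have p: "(\<Prod>s\<in>{0..t}. f s choose (q(t := d)) s) =
        (count_list \<alpha> t choose d) * ((k choose q 0) * (\<Prod>i = 1..<t. count_list \<alpha> i choose q i))" for d
      unfolding I using t by (simp add: f_def)
    have w: "(\<Prod>s\<in>{0..t}. a s ^ (q(t := d)) s) = a t ^ d * (a 0 ^ q 0 * (\<Prod>i = 1..<t. a i ^ q i))" for d
      unfolding I using t by simp
    have ft: "f t = count_list \<alpha> t" using t by (simp add: f_def)
    have "(\<Sum>d\<in>{0..f t}. of_nat (ffact k (d + ?v q) * (count_list \<alpha> t choose d)) * a t ^ d) =
      (\<Sum>d = 0..min (count_list \<alpha> t) (k - ?v q).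
        of_nat (fact (d + ?v q) * (k choose (d + ?v q)) * (count_list \<alpha> t choose d)) * a t ^ d)"
      unfolding ft
      by (intro sum.mono_neutral_cong_right) (auto simp: ffact_eq binomial_eq_0)
    then have "K_val k t a \<alpha> q (?v q) =
      of_nat (\<Prod>i = 1..<t. count_list \<alpha> i choose q i) * of_nat (k choose q 0) * a 0 ^ q 0 *
      (\<Prod>i = 1..<t. a i ^ q i) *
      (\<Sum>d\<in>{0..f t}. of_nat (ffact k (d + ?v q) * (count_list \<alpha> t choose d)) * a t ^ d)"
      unfolding K_val_def by (simp add: v)
    then show ?thesis
      unfolding s p w \<beta>_eq by (simp add: sum_distrib_left sum_distrib_right mult_ac)
  qed
  \<comment> \<open>The entry formula demands v at most k. The remaining q put more than k rooks
    into k rows and contribute 0.\<close>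
  let ?P' = "{q \<in> ?P. ?v q \<le> k}"
  have K0: "K_val k t a \<alpha> q (?v q) = 0" if "\<not> ?v q \<le> k" for q
    using that by (simp add: K_val_def binomial_eq_0)
  have adm: "K_adm k t \<alpha> (?\<beta> q) q (?v q)" if q: "q \<in> ?P'" for q
  proof -
    have "k - ?v q + (\<Sum>i = 1..<t. q i) = k - q 0"
      using q v[of q] by simp
    moreover have "q i \<le> count_list \<alpha> i" if "i \<in> {1..<t}" for i
    proof -
      have "q i \<in> {0..f i}" using q that by (intro PiE_mem[of q "{0..<t}"]) auto
      then show ?thesis using that by (simp add: f_def)
    qed
    ultimately show ?thesis
      using q v[of q] unfolding K_adm_def by auto
  qed
  have inj: "inj_on ?\<beta> ?P'"
  proof (rule inj_onI)
    fix q q' assume q: "q \<in> ?P'" and q': "q' \<in> ?P'" and eq: "?\<beta> q = ?\<beta> q'"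
    have "q s = q' s" if s: "s \<in> {0..<t}" for s
    proof -
      have b: "q s \<le> f s" "q' s \<le> f s"
        using PiE_mem[of q "{0..<t}" _ s] PiE_mem[of q' "{0..<t}" _ s] q q' s by auto
      have "count_list (?\<beta> q) (Suc s) = count_list (?\<beta> q') (Suc s)" using eq by simp
      then show ?thesis
        using b s by (auto simp: shift_seq_def count_mult_seq f_def split: if_splits)
    qed
    then show "q = q'" using q q' by (intro PiE_ext[of q "{0..<t}" _ q']) auto
  qed
  have img: "?\<beta> ` ?P' \<subseteq> G_set k t"
  proof -
    have "count_list \<alpha> i - m \<le> k" for i m
      using count_list_G_set(1)[OF \<alpha>, of i] by linarith
    then show ?thesis
      by (auto simp: shift_seq_def intro!: mult_seq_in_G_set)
  qed
  have out: "K_entry k t a \<alpha> \<beta> = 0" if \<beta>: "\<beta> \<in> G_set k t - ?\<beta> ` ?P'" for \<beta>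
  proof (rule K_entry_eq_0[OF t], rule notI)
    assume "\<exists>p v. K_adm k t \<alpha> \<beta> p v"
    then obtain p v where K: "K_adm k t \<alpha> \<beta> p v" by blast
    \<comment> \<open>The usage of block 0 is what is left of v after the blocks 1 to t - 1; an
      admissible pair of p and v thus comes from some q in \<open>?P'\<close>.\<close>
    define q where "q = restrict (\<lambda>s. if s = 0 then v - (\<Sum>i = 1..<t. p i) else p s) {0..<t}"
    have q0: "q 0 = v - (\<Sum>i = 1..<t. p i)" using t by (simp add: q_def)
    have qi: "q i = p i" if "i \<in> {1..<t}" for i using that by (simp add: q_def)
    have sq: "(\<Sum>i = 1..<t. q i) = (\<Sum>i = 1..<t. p i)" using qi by simp
    have "?v q = v" using K v[of q] q0 sq by (simp add: K_adm_def)
    moreover have "q \<in> ?P"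
      using K by (auto simp: q_def K_adm_def f_def)
    ultimately have "q \<in> ?P'" using K by (simp add: K_adm_def)
    moreover have "\<beta> = ?\<beta> q"
    proof -
      have "k - v + (\<Sum>i = 1..<t. p i) = k - q 0" using K q0 by (simp add: K_adm_def)
      then have "\<beta> = shift_seq t \<alpha> (k - q 0) p" using K by (simp add: K_adm_def)
      also have "\<dots> = ?\<beta> q" by (intro shift_seq_cong) (use qi in auto)
      finally show ?thesis .
    qed
    ultimately show False using \<beta> by blast
  qed
  have finP: "finite ?P" by (intro finite_PiE) auto
  have "(\<Sum>q\<in>PiE {0..t} (\<lambda>s. {0..f s}).
       of_nat (ffact k (\<Sum>s\<in>{0..t}. q s) * (\<Prod>s\<in>{0..t}. f s choose q s)) * (\<Prod>s\<in>{0..t}. a s ^ q s) *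
       X (mult_seq t (\<lambda>j. f (j - 1) - q (j - 1)))) =
     (\<Sum>q\<in>?P. K_val k t a \<alpha> q (?v q) * X (?\<beta> q))"
    by (subst I(1), subst sum_PiE_insert) (auto simp only: inner atLeastLessThan_iff)
  also have "\<dots> = (\<Sum>q\<in>?P'. K_entry k t a \<alpha> (?\<beta> q) * X (?\<beta> q))"
    using finP K0 K_entry_eq[OF t adm, where a = a] by (intro sum.mono_neutral_cong_right) auto
  also have "\<dots> = (\<Sum>\<beta>\<in>?\<beta> ` ?P'. K_entry k t a \<alpha> \<beta> * X \<beta>)"
    by (subst sum.reindex[OF inj]) simp
  also have "\<dots> = (\<Sum>\<beta>\<in>G_set k t. K_entry k t a \<alpha> \<beta> * X \<beta>)"
    using img out finite_G_set by (intro sum.mono_neutral_left) auto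
  finally show ?thesis by simp
qed

text \<open>Classes that neither the remaining rows nor \<open>E\<close> can see may hold any number
  of free columns. This is what permits a block to be dropped once it has left the window.\<close>

lemma rook_op_cong_on:
  assumes E: "\<And>f g. (\<And>x. x \<in> D \<Longrightarrow> f x = g x) \<Longrightarrow> E f = E g"
    and u: "\<And>\<rho> e. \<rho> < N \<Longrightarrow> e \<in> C - D \<Longrightarrow> u \<rho> e = 0"
    and fg: "\<And>x. x \<in> D \<Longrightarrow> f x = g x"
  shows "rook_op C u E N f = rook_op C u E N g"
  using u fg
proof (induction N arbitrary: f g)
  case 0
  show ?case unfolding rook_op.simps by (rule E) (rule 0(2))
next
  case (Suc N)
  have "u N e * of_nat (f e) * rook_op C u E N (f(e := f e - 1)) =
        u N e * of_nat (g e) * rook_op C u E N (g(e := g e - 1))" if e: "e \<in> C" for e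
  proof (cases "e \<in> D")
    case True
    then have "rook_op C u E N (f(e := f e - 1)) = rook_op C u E N (g(e := g e - 1))"
      using Suc.prems by (intro Suc.IH) auto
    then show ?thesis using Suc.prems(2)[OF True] by simp
  next
    case False
    then show ?thesis using Suc.prems(1)[of N e] e by simp
  qed
  moreover have "rook_op C u E N f = rook_op C u E N g"
    using Suc.prems by (intro Suc.IH) auto
  ultimately show ?case by simp
qed

text \<open>The common cover of both matrix families: row block i meets exactly the column blocks i
  to i + t. The offset r is left to the map from blocks of the band to columns of the
  matrix.\<close>

definition band :: "nat \<Rightarrow> nat \<Rightarrow> (nat \<Rightarrow> 'b::comm_ring_1) \<Rightarrow> nat \<Rightarrow> nat \<Rightarrow> 'b" where
  "band k t a \<rho> e = (if \<rho> div k \<le> e \<and> e \<le> \<rho> div k + t then a (e - \<rho> div k) else 0)"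

text \<open>The free columns when the row blocks 0 to n - 1 are still to be filled. Blocks before n
  are untouched, and \<alpha> describes the t blocks from n on, its letter 1 standing for block
  n.\<close>

definition window_state :: "nat \<Rightarrow> nat \<Rightarrow> nat list \<Rightarrow> nat \<Rightarrow> nat" where
  "window_state k n \<alpha> x = (if x < n then k else count_list \<alpha> (x - n + 1))"

text \<open>One step of the walk fills the last remaining row block and moves the window one block
  to the left. The bound \<open>n'\<close> keeps the set of column blocks fixed while n decreases,
  and \<open>Z\<close> is an arbitrary weight on the end state, to be specialised for each of the
  two matrix families.\<close>

lemma walk_K_eq_rook_op:
  fixes a :: "nat \<Rightarrow> 'b::comm_ring_1"
  assumes k: "1 \<le> k" and "n \<le> n'" and \<alpha>: "\<alpha> \<in> G_set k t"
  shows "(\<Sum>\<gamma>\<in>G_set k t. walk (G_set k t) (K_entry k t a) n \<alpha> \<gamma> * Z \<gamma>) =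
    rook_op {0..<n' + t} (band k t a) (\<lambda>h. Z (mult_seq t (\<lambda>j. h (j - 1)))) (n * k) (window_state k n \<alpha>)"
  using assms(2-)
proof (induction n arbitrary: \<alpha>)
  case 0
  have "mult_seq t (\<lambda>j. window_state k 0 \<alpha> (j - 1)) = mult_seq t (count_list \<alpha>)"
    unfolding mult_seq_eq_iff by (simp add: window_state_def)
  then have "mult_seq t (\<lambda>j. window_state k 0 \<alpha> (j - 1)) = \<alpha>"
    using 0 by (simp add: mult_seq_count_list)
  moreover have "(\<Sum>\<gamma>\<in>G_set k t. walk (G_set k t) (K_entry k t a) 0 \<alpha> \<gamma> * Z \<gamma>) = (\<Sum>\<gamma>\<in>{\<alpha>}. Z \<gamma>)"
    using 0 finite_G_set by (intro sum.mono_neutral_cong_right) auto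
  ultimately show ?case by simp
next
  case (Suc n)
  let ?G = "G_set k t" and ?C = "{0..<n' + t}" and ?W = "{n..n + t}" and ?u = "band k t a"
  let ?E = "\<lambda>h. Z (mult_seq t (\<lambda>j. h (j - 1)))"
  let ?f = "\<lambda>s. if s = 0 then k else count_list \<alpha> s"
  let ?F = "window_state k (Suc n) \<alpha>"
  let ?X = "\<lambda>\<beta>. rook_op ?C ?u ?E (n * k) (window_state k n \<beta>)"
  \<comment> \<open>At s = 0 this is block n, which is still full; for positive s the offset in
    \<open>window_state\<close> gives back letter s.\<close>
  have Ff: "?F (s + n) = ?f s" for s
    using count_list_G_set(2)[OF Suc.prems(2), of 0] by (auto simp: window_state_def)
  have "(\<Sum>\<gamma>\<in>?G. walk ?G (K_entry k t a) (Suc n) \<alpha> \<gamma> * Z \<gamma>) =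
     (\<Sum>\<beta>\<in>?G. K_entry k t a \<alpha> \<beta> * (\<Sum>\<gamma>\<in>?G. walk ?G (K_entry k t a) n \<beta> \<gamma> * Z \<gamma>))"
    unfolding walk.simps sum_distrib_left sum_distrib_right mult.assoc by (rule sum.swap)
  also have "\<dots> = (\<Sum>\<beta>\<in>?G. K_entry k t a \<alpha> \<beta> * ?X \<beta>)"
    using Suc.IH Suc.prems by (intro sum.cong refl) auto
  also have "\<dots> = (\<Sum>q\<in>PiE {0..t} (\<lambda>s. {0..?f s}).
       of_nat (ffact k (\<Sum>s\<in>{0..t}. q s) * (\<Prod>s\<in>{0..t}. ?f s choose q s)) * (\<Prod>s\<in>{0..t}. a s ^ q s) *
       ?X (mult_seq t (\<lambda>j. ?f (j - 1) - q (j - 1))))"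
    by (rule sum_K_entry[OF Suc.prems(2)])
  also have "\<dots> = (\<Sum>q\<in>PiE ?W (\<lambda>e. {0..?F e}).
       of_nat (ffact k (\<Sum>e\<in>?W. q e) * (\<Prod>e\<in>?W. ?F e choose q e)) * (\<Prod>e\<in>?W. a (e - n) ^ q e) *
       rook_op ?C ?u ?E (n * k) (\<lambda>e. if e \<in> ?W then ?F e - q e else ?F e))"
  proof (rule sum.reindex_bij_witness[where i = "\<lambda>q. restrict (\<lambda>s. q (s + n)) {0..t}"
        and j = "\<lambda>q. restrict (\<lambda>e. q (e - n)) ?W"])
    fix q assume q: "q \<in> PiE {0..t} (\<lambda>s. {0..?f s})"
    show "restrict (\<lambda>s. restrict (\<lambda>e. q (e - n)) ?W (s + n)) {0..t} = q"
      using q by (auto simp: fun_eq_iff PiE_def extensional_def)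
    show "restrict (\<lambda>e. q (e - n)) ?W \<in> PiE ?W (\<lambda>e. {0..?F e})"
    proof (rule restrict_PiE_iff[THEN iffD2], rule ballI)
      fix e assume e: "e \<in> ?W"
      then have "q (e - n) \<in> {0..?f (e - n)}"
        using q by (intro PiE_mem[of q "{0..t}"]) auto
      then show "q (e - n) \<in> {0..?F e}"
        using Ff[of "e - n"] e by simp
    qed
    let ?q = "restrict (\<lambda>e. q (e - n)) ?W"
    have W: "?W = {0 + n..t + n}" by (simp add: add.commute)
    have qs: "?q (s + n) = q s" if "s \<in> {0..t}" for s using that by simp
    have s: "(\<Sum>e\<in>?W. ?q e) = (\<Sum>s\<in>{0..t}. q s)"
      unfolding W sum.shift_bounds_cl_nat_ivl by (intro sum.cong) auto
    have p: "(\<Prod>e\<in>?W. ?F e choose ?q e) = (\<Prod>s\<in>{0..t}. ?f s choose q s)"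
      unfolding W prod.shift_bounds_cl_nat_ivl Ff by (intro prod.cong) auto
    have w: "(\<Prod>e\<in>?W. a (e - n) ^ ?q e) = (\<Prod>s\<in>{0..t}. a s ^ q s)"
      unfolding W prod.shift_bounds_cl_nat_ivl by (intro prod.cong) auto
    \<comment> \<open>The two states may differ at block n + t, where columns can be left over. The
      remaining rows do not reach this block and \<open>?E\<close> reads the blocks 0 to t - 1
      only.\<close>
    have X: "rook_op ?C ?u ?E (n * k) (\<lambda>e. if e \<in> ?W then ?F e - ?q e else ?F e) =
        ?X (mult_seq t (\<lambda>j. ?f (j - 1) - q (j - 1)))"
    proof (rule rook_op_cong_on[where D = "{0..<n + t}"])
      fix f g :: "nat \<Rightarrow> nat" assume "\<And>x. x \<in> {0..<n + t} \<Longrightarrow> f x = g x"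
      then have "mult_seq t (\<lambda>j. f (j - 1)) = mult_seq t (\<lambda>j. g (j - 1))"
        unfolding mult_seq_eq_iff by auto
      then show "?E f = ?E g" by simp
    next
      fix \<rho> e assume \<rho>: "\<rho> < n * k" and e: "e \<in> ?C - {0..<n + t}"
      then have "\<rho> div k < n" by (simp add: less_mult_imp_div_less)
      then show "?u \<rho> e = 0" using e by (auto simp: band_def)
    next
      fix x assume x: "x \<in> {0..<n + t}"
      show "(if x \<in> ?W then ?F x - ?q x else ?F x) =
        window_state k n (mult_seq t (\<lambda>j. ?f (j - 1) - q (j - 1))) x"
      proof (cases "x < n")
        case True
        then show ?thesis by (simp add: window_state_def)
      next
        case False
        then obtain s where s: "x = s + n" by (intro that[of "x - n"]) simp
        then have "s < t" using x by simp
        then have "window_state k n (mult_seq t (\<lambda>j. ?f (j - 1) - q (j - 1))) x = ?f s - q s"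
          unfolding s by (simp add: window_state_def count_mult_seq)
        moreover have "x \<in> ?W" "?q x = q s" "?F x = ?f s"
          using s \<open>s < t\<close> Ff[of s] by auto
        ultimately show ?thesis by simp
      qed
    qed
    show "of_nat (ffact k (\<Sum>e\<in>?W. ?q e) * (\<Prod>e\<in>?W. ?F e choose ?q e)) * (\<Prod>e\<in>?W. a (e - n) ^ ?q e) *
       rook_op ?C ?u ?E (n * k) (\<lambda>e. if e \<in> ?W then ?F e - ?q e else ?F e) =
      of_nat (ffact k (\<Sum>s\<in>{0..t}. q s) * (\<Prod>s\<in>{0..t}. ?f s choose q s)) * (\<Prod>s\<in>{0..t}. a s ^ q s) *
       ?X (mult_seq t (\<lambda>j. ?f (j - 1) - q (j - 1)))"
      unfolding s p w X ..
  next
    fix q assume q: "q \<in> PiE ?W (\<lambda>e. {0..?F e})"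
    show "restrict (\<lambda>e. restrict (\<lambda>s. q (s + n)) {0..t} (e - n)) ?W = q"
      using q by (auto simp: fun_eq_iff PiE_def extensional_def)
    show "restrict (\<lambda>s. q (s + n)) {0..t} \<in> PiE {0..t} (\<lambda>s. {0..?f s})"
    proof (rule restrict_PiE_iff[THEN iffD2], rule ballI)
      fix s assume s: "s \<in> {0..t}"
      then have "q (s + n) \<in> {0..?F (s + n)}"
        using q by (intro PiE_mem[of q ?W]) auto
      then show "q (s + n) \<in> {0..?f s}"
        unfolding Ff .
    qed
  qed
  also have "\<dots> = rook_op ?C ?u ?E (n * k + k) ?F"
  proof (rule rook_op_block[symmetric])
    show "?W \<subseteq> ?C" using Suc.prems by auto
    fix \<rho> e assume "n * k \<le> \<rho>" "\<rho> < n * k + k"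
    then have "\<rho> div k = n"
      by (intro div_nat_eqI) (auto simp: mult.commute)
    then show "?u \<rho> e = (if e \<in> ?W then a (e - n) else 0)"
      by (simp add: band_def)
  qed simp
  finally show ?case by (simp only: mult_Suc add.commute[of k])
qed

subsection \<open>Toeplitz and circulant matrices\<close>

lemma mult_seq_extend:
  assumes "r \<le> t"
  shows "mult_seq r l = mult_seq t (\<lambda>i. if i \<le> r then l i else 0)"
proof -
  have split: "[1..<Suc t] = [1..<Suc r] @ [Suc r..<Suc t]"
    using assms upt_add_eq_append[of 1 "Suc r" "t - r"] by simp
  have tail: "concat (map (\<lambda>i. replicate (if i \<le> r then l i else 0) i) [Suc r..<Suc t]) = []"
    by auto
  have head: "map (\<lambda>i. replicate (if i \<le> r then l i else 0) i) [1..<Suc r] =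
      map (\<lambda>i. replicate (l i) i) [1..<Suc r]"
    by (intro map_cong) auto
  show ?thesis
    unfolding mult_seq_def split map_append concat_append tail head by simp
qed

lemma full_seq_in_G_set: "r \<le> t \<Longrightarrow> mult_seq r (\<lambda>_. k) \<in> G_set k t"
  unfolding mult_seq_extend by (rule mult_seq_in_G_set) simp

text \<open>The true columns are the blocks in \<open>?C'\<close>. The initial state makes the
  blocks from n + r on empty of columns and those below r full. \<open>?Z\<close> then asks that the
  first r blocks are still full at the end, so no rook was placed outside the matrix.\<close>

lemma rook_poly_toeplitz:
  fixes b :: "nat \<Rightarrow> 'a::comm_ring_1"
  assumes k: "1 \<le> k" and r: "r \<le> t"
  shows "rook_poly (kronecker (mat_sum n (\<lambda>i. b i \<cdot>\<^sub>m toeplitz_unit n (int i - int r)) {0..t}) (ones_mat k)) =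
    (\<Sum>\<gamma> | \<gamma> \<in> G_set k t \<and> (\<forall>i\<in>{1..r}. count_list \<gamma> i = k).
       walk (G_set k t) (K_entry k t (\<lambda>i. monom (b i) 1)) n (mult_seq r (\<lambda>_. k)) \<gamma>)"
proof -
  let ?T = "mat_sum n (\<lambda>i. b i \<cdot>\<^sub>m toeplitz_unit n (int i - int r)) {0..t}"
  let ?a = "\<lambda>i. monom (b i) 1" and ?\<delta> = "mult_seq r (\<lambda>_. k)"
  let ?C = "{0..<n + t}" and ?C' = "{r..<n + r}" and ?u = "band k t (\<lambda>i. monom (b i) 1)"
  let ?Z = "\<lambda>\<gamma>. if \<forall>i\<in>{1..r}. count_list \<gamma> i = k then 1 else 0 :: 'a poly"
  let ?f = "window_state k n ?\<delta>"
  have T: "?T $$ (i, j) = (if i \<le> j + r \<and> j + r \<le> i + t then b (j + r - i) else 0)" if "i < n" "j < n" for i j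
  proof -
    have "?T $$ (i, j) = (\<Sum>s\<in>{0..t}. if int j - int i = int s - int r then b s else 0)"
      using that by (auto simp: mat_sum_def toeplitz_unit_def intro!: sum.cong)
    also have "\<dots> = (\<Sum>s\<in>{0..t}. if i \<le> j + r \<and> s = j + r - i then b s else 0)"
      by (intro sum.cong refl if_cong) auto
    also have "\<dots> = (if i \<le> j + r \<and> j + r \<le> i + t then b (j + r - i) else 0)"
      by (cases "i \<le> j + r") (auto simp: sum.delta)
    finally show ?thesis .
  qed
  have Tc: "?T \<in> carrier_mat n n" by (simp add: mat_sum_def)
  have f: "?f e = (if e < n + r then k else 0)" for e
    by (auto simp: window_state_def count_mult_seq)
  have "rook_poly (kronecker ?T (ones_mat k)) =
     rook_op {0..<n} (\<lambda>\<rho> J. monom (?T $$ (\<rho> div k, J)) 1) (\<lambda>_. 1) (n * k) (\<lambda>J. if J < n then k else 0)"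
    by (rule rook_poly_kronecker_ones[OF k Tc])
  also have "\<dots> = usage_op ?C ?u (n * k)
      (\<lambda>m. of_nat (\<Prod>x\<in>{0..<n}. ffact (if x < n then k else 0) (\<Sum>e | e \<in> ?C' \<and> e - r = x. m e)) *
        (if \<forall>e\<in>?C - ?C'. m e = 0 then 1 else 0))"
  proof (rule rook_op_merge)
    fix \<rho> x assume \<rho>: "\<rho> < n * k" and x: "x \<in> {0..<n}"
    then have "\<rho> div k < n" by (simp add: less_mult_imp_div_less)
    moreover have "{e. e \<in> ?C' \<and> e - r = x} = {x + r}" using x by auto
    ultimately show "monom (?T $$ (\<rho> div k, x)) 1 = (\<Sum>e | e \<in> ?C' \<and> e - r = x. ?u \<rho> e)"
      using T x by (simp add: band_def)
  qed (use r in auto)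
  also have "\<dots> = usage_op ?C ?u (n * k)
      (\<lambda>m. of_nat (\<Prod>e\<in>?C. ffact (?f e) (m e)) * ?Z (mult_seq t (\<lambda>j. ?f (j - 1) - m (j - 1))))"
  proof (rule arg_cong[where f = "usage_op ?C ?u (n * k)"], rule ext)
    fix m :: "nat \<Rightarrow> nat"
    have Z: "?Z (mult_seq t (\<lambda>j. ?f (j - 1) - m (j - 1))) = (if \<forall>x<r. ?f x - m x = k then 1 else 0)"
    proof -
      have "(\<forall>i\<in>{1..r}. count_list (mult_seq t (\<lambda>j. ?f (j - 1) - m (j - 1))) i = k) \<longleftrightarrow>
          (\<forall>i\<in>{1..r}. ?f (i - 1) - m (i - 1) = k)"
        using r by (intro ball_cong) (auto simp: count_mult_seq)
      also have "\<dots> \<longleftrightarrow> (\<forall>x<r. ?f x - m x = k)"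
      proof
        assume *: "\<forall>i\<in>{1..r}. ?f (i - 1) - m (i - 1) = k"
        show "\<forall>x<r. ?f x - m x = k"
        proof (intro allI impI)
          fix x assume "x < r"
          then show "?f x - m x = k" using bspec[OF *, of "Suc x"] by simp
        qed
      qed auto
      finally show ?thesis by simp
    qed
    have "(\<Prod>x\<in>{0..<n}. ffact (if x < n then k else 0) (\<Sum>e | e \<in> ?C' \<and> e - r = x. m e)) =
        (\<Prod>x\<in>{0..<n}. ffact k (m (x + r)))"
    proof (intro prod.cong refl)
      fix x assume x: "x \<in> {0..<n}"
      then have "{e. e \<in> ?C' \<and> e - r = x} = {x + r}" by auto
      then show "ffact (if x < n then k else 0) (\<Sum>e | e \<in> ?C' \<and> e - r = x. m e) = ffact k (m (x + r))"
        using x by simp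
    qed
    also have "\<dots> = (\<Prod>e\<in>?C'. ffact k (m e))"
      using prod.shift_bounds_nat_ivl[of "\<lambda>e. ffact k (m e)" 0 r n] by simp
    finally have P: "(\<Prod>x\<in>{0..<n}. ffact (if x < n then k else 0) (\<Sum>e | e \<in> ?C' \<and> e - r = x. m e)) =
        (\<Prod>e\<in>?C'. ffact k (m e))" .
    show "of_nat (\<Prod>x\<in>{0..<n}. ffact (if x < n then k else 0) (\<Sum>e | e \<in> ?C' \<and> e - r = x. m e)) *
        (if \<forall>e\<in>?C - ?C'. m e = 0 then 1 else 0) =
      of_nat (\<Prod>e\<in>?C. ffact (?f e) (m e)) * ?Z (mult_seq t (\<lambda>j. ?f (j - 1) - m (j - 1)))"
    proof (cases "\<forall>e\<in>?C - ?C'. m e = 0")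
      case True
      have "(\<Prod>e\<in>?C. ffact (?f e) (m e)) = (\<Prod>e\<in>?C'. ffact k (m e))"
        using True r by (intro prod.mono_neutral_cong_right) (auto simp: f)
      moreover have "\<forall>x<r. ?f x - m x = k"
        using True r by (auto simp: f)
      ultimately show ?thesis
        unfolding P Z using True by simp
    next
      case False
      then obtain e where e: "e \<in> ?C - ?C'" "m e \<noteq> 0" by blast
      have "(\<Prod>e\<in>?C. ffact (?f e) (m e)) = 0 \<or> \<not> (\<forall>x<r. ?f x - m x = k)"
      proof (cases "e < r")
        case True
        \<comment> \<open>This needs k positive: truncated at 0, the difference could otherwise not
          reveal a rook.\<close>
        then have "?f e - m e \<noteq> k" using e k by (auto simp: f)
        then show ?thesis using True by blast
      next
        case False
        then have "ffact (?f e) (m e) = 0" using e by (intro ffact_eq_0) (auto simp: f)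
        then show ?thesis using e by (auto intro!: prod_zero)
      qed
      then have "of_nat (\<Prod>e\<in>?C. ffact (?f e) (m e)) * (if \<forall>x<r. ?f x - m x = k then 1 else 0) = (0 :: 'a poly)"
        by (elim disjE) (simp_all only: of_nat_0 mult_zero_left mult_zero_right if_False)
      then show ?thesis
        unfolding Z if_not_P[OF False] by (simp only: mult_zero_right)
    qed
  qed
  also have "\<dots> = rook_op ?C ?u (\<lambda>h. ?Z (mult_seq t (\<lambda>j. h (j - 1)))) (n * k) ?f"
    by (rule rook_op_eq_usage_op[symmetric]) simp
  also have "\<dots> = (\<Sum>\<gamma>\<in>G_set k t. walk (G_set k t) (K_entry k t ?a) n ?\<delta> \<gamma> * ?Z \<gamma>)"
    by (rule walk_K_eq_rook_op[OF k order_refl full_seq_in_G_set[OF r], symmetric])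
  also have "\<dots> = (\<Sum>\<gamma> | \<gamma> \<in> G_set k t \<and> (\<forall>i\<in>{1..r}. count_list \<gamma> i = k).
       walk (G_set k t) (K_entry k t ?a) n ?\<delta> \<gamma>)"
    using finite_G_set by (intro sum.mono_neutral_cong_right) auto
  finally show ?thesis .
qed

text \<open>The closed form of the integer powers of the cyclic matrix, uniform in negative
  exponents and in exponents beyond n; see \<open>int_pow_cyclic_mat\<close>.\<close>

definition shift_mat :: "nat \<Rightarrow> int \<Rightarrow> 'a::comm_ring_1 mat" where
  "shift_mat n s = mat n n (\<lambda>(i, j). if [int j - int i = s] (mod int n) then 1 else 0)"

lemma shift_mat_mult:
  assumes "1 \<le> n"
  shows "shift_mat n s * shift_mat n s' = (shift_mat n (s + s') :: 'a::comm_ring_1 mat)"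
proof (rule eq_matI)
  fix i j assume "i < dim_row (shift_mat n (s + s') :: 'a mat)" "j < dim_col (shift_mat n (s + s') :: 'a mat)"
  then have ij: "i < n" "j < n" by (simp_all add: shift_mat_def)
  \<comment> \<open>The column of the only 1 in row i of the first factor.\<close>
  define l where "l = nat ((int i + s) mod int n)"
  have l: "l < n" "int l = (int i + s) mod int n"
    using assms by (auto simp: l_def nat_less_iff)
  have uniq: "[int x - int i = s] (mod int n) \<longleftrightarrow> x = l" if "x < n" for x
  proof -
    have "[int x - int i = s] (mod int n) \<longleftrightarrow> [int x = int i + s] (mod int n)"
      by (metis add.commute add_diff_cancel_right' cong_add_lcancel diff_add_cancel)
    also have "\<dots> \<longleftrightarrow> int x = int l"
      using that l by (simp add: cong_def)
    finally show ?thesis by simp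
  qed
  have "(shift_mat n s * shift_mat n s') $$ (i, j) =
     (\<Sum>x\<in>{0..<n}. (if [int x - int i = s] (mod int n) then 1 else 0) *
        (if [int j - int x = s'] (mod int n) then 1 else 0 :: 'a))"
    using ij by (simp add: shift_mat_def times_mat_def scalar_prod_def)
  also have "\<dots> = (\<Sum>x\<in>{l}. if [int j - int x = s'] (mod int n) then 1 else 0)"
    using l(1) uniq by (intro sum.mono_neutral_cong_right) auto
  also have "[int j - int l = s'] (mod int n) \<longleftrightarrow> [int j - int i = s + s'] (mod int n)"
  proof -
    have "[int j - int l = int j - (int i + s)] (mod int n)"
      unfolding l by (intro cong_diff) (auto simp: cong_def)
    then have "[int j - int l = s'] (mod int n) \<longleftrightarrow> [int j - (int i + s) = s'] (mod int n)"
      using cong_sym cong_trans by blast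
    also have "\<dots> \<longleftrightarrow> [int j - int i = s + s'] (mod int n)"
      by (simp add: cong_iff_dvd_diff algebra_simps)
    finally show ?thesis .
  qed
  then have "(\<Sum>x\<in>{l}. if [int j - int x = s'] (mod int n) then 1 else 0) = shift_mat n (s + s') $$ (i, j)"
    using ij by (simp add: shift_mat_def)
  finally show "(shift_mat n s * shift_mat n s') $$ (i, j) = (shift_mat n (s + s') :: 'a mat) $$ (i, j)" .
qed (simp_all add: shift_mat_def)

lemma shift_mat_0: "shift_mat n 0 = (1\<^sub>m n :: 'a::comm_ring_1 mat)"
proof (rule eq_matI)
  fix i j assume "i < dim_row (1\<^sub>m n :: 'a mat)" "j < dim_col (1\<^sub>m n :: 'a mat)"
  then have ij: "i < n" "j < n" by simp_all
  have "[int j - int i = 0] (mod int n) \<longleftrightarrow> [int j = int i] (mod int n)"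
    by (rule cong_diff_iff_cong_0)
  also have "\<dots> \<longleftrightarrow> i = j"
    using ij by (auto simp: cong_def)
  finally show "shift_mat n 0 $$ (i, j) = (1\<^sub>m n :: 'a mat) $$ (i, j)"
    using ij by (simp add: shift_mat_def)
qed (simp_all add: shift_mat_def)

lemma shift_mat_carrier: "shift_mat n s \<in> carrier_mat n n"
  by (simp add: shift_mat_def)

lemma pow_shift_mat: "1 \<le> n \<Longrightarrow> shift_mat n s ^\<^sub>m m = (shift_mat n (int m * s) :: 'a::comm_ring_1 mat)"
proof (induction m)
  case 0
  have "dim_row (shift_mat n s :: 'a mat) = n" by (simp add: shift_mat_def)
  then show ?case by (simp add: shift_mat_0)
next
  case (Suc m)
  then show ?case by (simp add: shift_mat_mult algebra_simps)
qed

lemma inverse_mat_unique: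
  assumes "A \<in> carrier_mat n n" "B \<in> carrier_mat n n" "A * B = 1\<^sub>m n" "B * A = 1\<^sub>m n"
  shows "inverse_mat A = B"
  unfolding inverse_mat_def
proof (rule the_equality)
  show "B \<in> carrier_mat (dim_row A) (dim_row A) \<and> inverts_mat A B \<and> inverts_mat B A"
    using assms by (auto simp: inverts_mat_def)
  fix C assume C: "C \<in> carrier_mat (dim_row A) (dim_row A) \<and> inverts_mat A C \<and> inverts_mat C A"
  then have Cn: "C \<in> carrier_mat n n" and AC: "A * C = 1\<^sub>m n"
    using assms by (auto simp: inverts_mat_def)
  have "C = (B * A) * C" using Cn assms by simp
  also have "\<dots> = B * (A * C)" using assms Cn by (intro assoc_mult_mat) auto
  also have "\<dots> = B" using AC assms by simp
  finally show "C = B" .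
qed

lemma int_pow_cyclic_mat:
  assumes n: "1 \<le> n"
  shows "int_pow_mat (cyclic_mat n) s = (shift_mat n s :: 'a::comm_ring_1 mat)"
proof -
  have c: "cyclic_mat n = (shift_mat n 1 :: 'a mat)"
    by (simp add: cyclic_mat_def shift_mat_def)
  have "inverse_mat (shift_mat n 1) = (shift_mat n (- 1) :: 'a mat)"
    using n by (intro inverse_mat_unique[OF shift_mat_carrier shift_mat_carrier])
      (simp_all add: shift_mat_mult shift_mat_0)
  then show ?thesis
    unfolding int_pow_mat_def c using n by (simp add: pow_shift_mat)
qed

section \<open>Circulant matrices: folding the band modulo n\<close>

text \<open>The number of columns free at position \<open>x\<close> of the cover if it uses up the columns left over by
  position \<open>x - n\<close>, given that \<open>m\<close> rooks are placed.\<close>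

fun cyclic_state :: "nat \<Rightarrow> nat \<Rightarrow> (nat \<Rightarrow> nat) \<Rightarrow> nat \<Rightarrow> nat" where
  "cyclic_state k n m x = (if x < n \<or> n = 0 then k else cyclic_state k n m (x - n) - m (x - n))"

declare cyclic_state.simps [simp del]

lemma cyclic_state_eq:
  assumes "1 \<le> n"
  shows "cyclic_state k n m x = k - (\<Sum>e | e < x \<and> e mod n = x mod n. m e)"
proof (induction x rule: less_induct)
  case (less x)
  show ?case
  proof (cases "x < n")
    case True
    then have "{e. e < x \<and> e mod n = x mod n} = {}" by auto
    moreover have "cyclic_state k n m x = k"
      using True by (subst cyclic_state.simps) simp
    ultimately show ?thesis by (simp only: sum.empty diff_zero)
  next
    case False
    let ?A = "\<lambda>x. {e. e < x \<and> e mod n = x mod n}"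
    \<comment> \<open>Below x, the largest member of the residue class of x is x - n, so unrolling
      the recursion once adds exactly one usage.\<close>
    have "?A x = insert (x - n) (?A (x - n))"
    proof (intro equalityI subsetI)
      fix e assume e: "e \<in> ?A x"
      have "e = x - n \<or> e < x - n"
      proof (rule ccontr)
        assume "\<not> (e = x - n \<or> e < x - n)"
        then have "x - e < n" "0 < x - e" using e False by auto
        moreover have "n dvd x - e"
          using e by (intro mod_eq_dvd_iff_nat[THEN iffD1]) auto
        ultimately show False using nat_dvd_not_less by blast
      qed
      moreover have "(x - n) mod n = x mod n" using False by (simp add: le_mod_geq)
      ultimately show "e \<in> insert (x - n) (?A (x - n))" using e by auto
    next
      fix e assume "e \<in> insert (x - n) (?A (x - n))"
      moreover have "(x - n) mod n = x mod n" using False by (simp add: le_mod_geq)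
      ultimately show "e \<in> ?A x" using assms False by auto
    qed
    then have "(\<Sum>e\<in>?A x. m e) = m (x - n) + (\<Sum>e\<in>?A (x - n). m e)"
      by simp
    moreover have "cyclic_state k n m x = cyclic_state k n m (x - n) - m (x - n)"
      using False assms by (subst cyclic_state.simps) simp
    ultimately show ?thesis
      using less.IH[of "x - n"] assms False by (simp add: add.commute)
  qed
qed

text \<open>Within a residue class each position finds the capacity left by the earlier ones, and by
  \<open>ffact_add\<close> the factors collapse to one falling factorial of k in the total
  usage.\<close>

lemma prod_cyclic_state:
  assumes "1 \<le> n"
  shows "(\<Prod>e\<in>{0..<N}. ffact (cyclic_state k n m e) (m e)) =
    (\<Prod>x\<in>{0..<n}. ffact k (\<Sum>e | e < N \<and> e mod n = x. m e))"
proof (induction N)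
  case 0
  then show ?case by simp
next
  case (Suc N)
  let ?s = "\<lambda>N x. \<Sum>e | e < N \<and> e mod n = x. m e"
  let ?x = "N mod n"
  have x: "?x \<in> {0..<n}" using assms by simp
  have other: "?s (Suc N) x = ?s N x" if "x \<noteq> ?x" for x
    using that by (intro sum.cong) (auto simp: less_Suc_eq)
  have "{e. e < Suc N \<and> e mod n = ?x} = insert N {e. e < N \<and> e mod n = ?x}"
    by auto
  then have "?s (Suc N) ?x = ?s N ?x + m N" by simp
  then have new: "ffact k (?s (Suc N) ?x) = ffact k (?s N ?x) * ffact (cyclic_state k n m N) (m N)"
    by (simp add: ffact_add cyclic_state_eq[OF assms])
  have "(\<Prod>x\<in>{0..<n}. ffact k (?s (Suc N) x)) =
      ffact k (?s (Suc N) ?x) * (\<Prod>x\<in>{0..<n} - {?x}. ffact k (?s (Suc N) x))"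
    using x by (intro prod.remove) auto
  also have "(\<Prod>x\<in>{0..<n} - {?x}. ffact k (?s (Suc N) x)) = (\<Prod>x\<in>{0..<n} - {?x}. ffact k (?s N x))"
    using other by (intro prod.cong) auto
  also have "ffact k (?s (Suc N) ?x) * \<dots> =
      (ffact k (?s N ?x) * (\<Prod>x\<in>{0..<n} - {?x}. ffact k (?s N x))) * ffact (cyclic_state k n m N) (m N)"
    unfolding new by (simp add: mult_ac)
  also have "ffact k (?s N ?x) * (\<Prod>x\<in>{0..<n} - {?x}. ffact k (?s N x)) = (\<Prod>x\<in>{0..<n}. ffact k (?s N x))"
    using x by (intro prod.remove[symmetric]) auto
  finally show ?case using Suc.IH by simp
qed

text \<open>For fixed usages m, a state that returns to itself is forced: its first n blocks are
  full, and closure determines each later block from the one n places before. Exactly one \<alpha>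
  thus contributes to the trace, with the weight that the circulant matrix gives to m. The argument
  covers windows that wrap around several times.\<close>

lemma rook_poly_circulant:
  fixes b :: "nat \<Rightarrow> 'a::comm_ring_1"
  assumes k: "1 \<le> k" and n: "1 \<le> n"
  shows "rook_poly (kronecker (mat_sum n (\<lambda>i. b i \<cdot>\<^sub>m int_pow_mat (cyclic_mat n) (int i - int r)) {0..t}) (ones_mat k)) =
    (\<Sum>\<alpha>\<in>G_set k t. walk (G_set k t) (K_entry k t (\<lambda>i. monom (b i) 1)) n \<alpha> \<alpha>)"
proof -
  let ?P = "mat_sum n (\<lambda>i. b i \<cdot>\<^sub>m int_pow_mat (cyclic_mat n) (int i - int r)) {0..t}"
  let ?a = "\<lambda>i. monom (b i) 1"
  let ?C = "{0..<n + t}" and ?u = "band k t (\<lambda>i. monom (b i) 1)"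
  let ?G = "G_set k t"
  \<comment> \<open>Block e of the band covers column block e - r modulo n. The integer remainder
    sends the blocks below r to the right end of the matrix.\<close>
  define \<pi> where "\<pi> = (\<lambda>e. nat ((int e - int r) mod int n))"
  let ?f = "window_state k n"
  have \<pi>_iff: "\<pi> e = x \<longleftrightarrow> [int x = int e - int r] (mod int n)" if "x < n" for e x
    using that n by (auto simp: \<pi>_def cong_def nat_eq_iff)
  have \<pi>_less: "\<pi> e < n" for e
    using n by (simp add: \<pi>_def nat_less_iff)
  have Pc: "?P \<in> carrier_mat n n" by (simp add: mat_sum_def)
  \<comment> \<open>For n at most t several exponents agree modulo n, and an entry of the circulant
    sums their weights. These are the copies of column j among the blocks met by row i.\<close>
  have P: "monom (?P $$ (i, j)) 1 = (\<Sum>e | e \<in> ?C \<and> \<pi> e = j. if i \<le> e \<and> e \<le> i + t then ?a (e - i) else 0)"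
    if ij: "i < n" "j < n" for i j
  proof -
    have "?P $$ (i, j) = (\<Sum>s\<in>{0..t}. if [int j - int i = int s - int r] (mod int n) then b s else 0)"
      using ij n by (auto simp: mat_sum_def int_pow_cyclic_mat shift_mat_def intro!: sum.cong)
    then have "monom (?P $$ (i, j)) 1 = (\<Sum>s\<in>{0..t}. if [int j - int i = int s - int r] (mod int n) then ?a s else 0)"
      by (auto simp: Polynomial.monom_sum intro!: sum.cong)
    also have "\<dots> = (\<Sum>s\<in>{0..t}. if \<pi> (s + i) = j then ?a s else 0)"
    proof (intro sum.cong refl if_cong)
      fix s
      show "[int j - int i = int s - int r] (mod int n) \<longleftrightarrow> \<pi> (s + i) = j"
        unfolding \<pi>_iff[OF ij(2)] by (simp add: cong_iff_dvd_diff algebra_simps)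
    qed
    also have "\<dots> = (\<Sum>e\<in>{0 + i..t + i}. if \<pi> e = j then ?a (e - i) else 0)"
      unfolding sum.shift_bounds_cl_nat_ivl add_diff_cancel_right' ..
    also have "{0 + i..t + i} = {i..i + t}"
      by (simp add: add.commute)
    also have "(\<Sum>e\<in>{i..i + t}. if \<pi> e = j then ?a (e - i) else 0) =
        (\<Sum>e\<in>{e \<in> {i..i + t}. \<pi> e = j}. ?a (e - i))"
      by (rule sum.inter_filter[symmetric]) simp
    also have "\<dots> = (\<Sum>e | e \<in> ?C \<and> \<pi> e = j. if i \<le> e \<and> e \<le> i + t then ?a (e - i) else 0)"
      using ij by (intro sum.mono_neutral_cong_left) auto
    finally show ?thesis .
  qed
  have "rook_poly (kronecker ?P (ones_mat k)) =
     rook_op {0..<n} (\<lambda>\<rho> J. monom (?P $$ (\<rho> div k, J)) 1) (\<lambda>_. 1) (n * k) (\<lambda>J. if J < n then k else 0)"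
    by (rule rook_poly_kronecker_ones[OF k Pc])
  also have "\<dots> = usage_op ?C ?u (n * k)
      (\<lambda>m. of_nat (\<Prod>x\<in>{0..<n}. ffact (if x < n then k else 0) (\<Sum>e | e \<in> ?C \<and> \<pi> e = x. m e)) *
        (if \<forall>e\<in>?C - ?C. m e = 0 then 1 else 0))"
  proof (rule rook_op_merge)
    fix \<rho> x assume \<rho>: "\<rho> < n * k" and x: "x \<in> {0..<n}"
    then have "\<rho> div k < n" by (simp add: less_mult_imp_div_less)
    then show "monom (?P $$ (\<rho> div k, x)) 1 = (\<Sum>e | e \<in> ?C \<and> \<pi> e = x. ?u \<rho> e)"
      using x unfolding band_def by (intro P) auto
  next
    show "\<pi> ` ?C \<subseteq> {0..<n}" using \<pi>_less by auto
  qed auto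
  also have "\<dots> = usage_op ?C ?u (n * k)
      (\<lambda>m. \<Sum>\<alpha>\<in>?G. of_nat (\<Prod>e\<in>?C. ffact (?f \<alpha> e) (m e)) *
        (if mult_seq t (\<lambda>j. ?f \<alpha> (j - 1) - m (j - 1)) = \<alpha> then 1 else 0))"
  proof (rule arg_cong[where f = "usage_op ?C ?u (n * k)"], rule ext)
    fix m :: "nat \<Rightarrow> nat"
    let ?S = "cyclic_state k n m"
    \<comment> \<open>The only possible closed state: the cyclic recursion read off in the initial
      window, at the positions n to n + t - 1.\<close>
    let ?\<alpha> = "mult_seq t (\<lambda>j. ?S (n + j - 1))"
    have S_le: "?S x \<le> k" for x
      by (simp add: cyclic_state_eq[OF n])
    have \<alpha>G: "?\<alpha> \<in> ?G" by (rule mult_seq_in_G_set) (rule S_le)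
    have S_ge: "?S x = ?S (x - n) - m (x - n)" if "\<not> x < n" for x
      using that n by (subst cyclic_state.simps) simp
    have S_lt: "?S x = k" if "x < n" for x
      using that by (subst cyclic_state.simps) simp
    have f\<alpha>: "?f ?\<alpha> x = ?S x" if "x < n + t" for x
      using that S_lt by (auto simp: window_state_def count_mult_seq)
    \<comment> \<open>The end window consists of the positions 0 to t - 1. Equality with \<alpha>,
      which sits n places further, is precisely the recursion of \<open>?S\<close>; for the
      converse, induction on the position pins \<alpha> down.\<close>
    have closed: "mult_seq t (\<lambda>j. ?f \<alpha> (j - 1) - m (j - 1)) = \<alpha> \<longleftrightarrow> \<alpha> = ?\<alpha>" if \<alpha>: "\<alpha> \<in> ?G" for \<alpha>
    proof
      assume "\<alpha> = ?\<alpha>"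
      moreover have "mult_seq t (\<lambda>j. ?f ?\<alpha> (j - 1) - m (j - 1)) = ?\<alpha>"
        unfolding mult_seq_eq_iff
      proof
        fix i assume i: "i \<in> {1..t}"
        then have "?f ?\<alpha> (i - 1) = ?S (i - 1)" by (intro f\<alpha>) auto
        moreover have "n + i - 1 = n + (i - 1)" using i by auto
        then have "?S (n + i - 1) = ?S (i - 1) - m (i - 1)"
          using S_ge[of "n + (i - 1)"] by simp
        ultimately show "?f ?\<alpha> (i - 1) - m (i - 1) = ?S (n + i - 1)" by simp
      qed
      ultimately show "mult_seq t (\<lambda>j. ?f \<alpha> (j - 1) - m (j - 1)) = \<alpha>" by simp
    next
      assume eq: "mult_seq t (\<lambda>j. ?f \<alpha> (j - 1) - m (j - 1)) = \<alpha>"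
      have cnt: "count_list \<alpha> j = ?f \<alpha> (j - 1) - m (j - 1)" if "1 \<le> j" "j \<le> t" for j
        using that by (subst eq[symmetric]) (simp add: count_mult_seq)
      have f_eq: "?f \<alpha> x = ?S x" if "x < n + t" for x
        using that
      proof (induction x rule: less_induct)
        case (less x)
        show ?case
        proof (cases "x < n")
          case True
          then show ?thesis by (simp add: window_state_def S_lt)
        next
          case False
          then have "?f \<alpha> x = count_list \<alpha> (x - n + 1)" by (simp add: window_state_def)
          also have "\<dots> = ?f \<alpha> (x - n) - m (x - n)"
            using cnt[of "x - n + 1"] less.prems False by simp
          also have "?f \<alpha> (x - n) = ?S (x - n)"
            using less n False by simp
          finally show ?thesis using S_ge[OF False] by simp
        qed
      qed
      show "\<alpha> = ?\<alpha>"
      proof (rule G_set_eqI[OF \<alpha> \<alpha>G])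
        fix i assume i: "1 \<le> i" "i \<le> t"
        then have "count_list \<alpha> i = ?f \<alpha> (n + i - 1)" by (simp add: window_state_def)
        also have "\<dots> = ?S (n + i - 1)" using i by (intro f_eq) simp
        finally show "count_list \<alpha> i = count_list ?\<alpha> i" using i by (simp add: count_mult_seq)
      qed
    qed
    have "(\<Sum>\<alpha>\<in>?G. of_nat (\<Prod>e\<in>?C. ffact (?f \<alpha> e) (m e)) *
        (if mult_seq t (\<lambda>j. ?f \<alpha> (j - 1) - m (j - 1)) = \<alpha> then 1 else 0)) =
      (\<Sum>\<alpha>\<in>{?\<alpha>}. of_nat (\<Prod>e\<in>?C. ffact (?f \<alpha> e) (m e)) :: 'a poly)"
      using finite_G_set \<alpha>G closed by (intro sum.mono_neutral_cong_right) auto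
    also have "\<dots> = of_nat (\<Prod>e\<in>?C. ffact (?S e) (m e))"
    proof -
      have "(\<Prod>e\<in>?C. ffact (?f ?\<alpha> e) (m e)) = (\<Prod>e\<in>?C. ffact (?S e) (m e))"
        using f\<alpha> by (intro prod.cong) auto
      then show ?thesis by simp
    qed
    also have "(\<Prod>e\<in>?C. ffact (?S e) (m e)) = (\<Prod>x\<in>{0..<n}. ffact k (\<Sum>e | e < n + t \<and> e mod n = x. m e))"
      by (rule prod_cyclic_state[OF n])
    \<comment> \<open>Residues of e and of e - r label the same classes; passing from one to the
      other rotates the factors by r.\<close>
    also have "\<dots> = (\<Prod>x\<in>{0..<n}. ffact k (\<Sum>e | e \<in> ?C \<and> \<pi> e = x. m e))"
    proof (rule prod.reindex_bij_witness[where i = "\<lambda>x. (x + r) mod n" and j = \<pi>])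
      fix x assume x: "x \<in> {0..<n}"
      show "(\<pi> x + r) mod n = x"
      proof -
        have "int ((\<pi> x + r) mod n) = ((int x - int r) mod int n + int r) mod int n"
          using n by (simp add: \<pi>_def zmod_int)
        also have "\<dots> = int x" using x by (simp add: mod_add_left_eq)
        finally show ?thesis by simp
      qed
      show "\<pi> x \<in> {0..<n}" using \<pi>_less by simp
      have "{e. e \<in> ?C \<and> \<pi> e = \<pi> x} = {e. e < n + t \<and> e mod n = x}"
      proof -
        have "\<pi> e = \<pi> x \<longleftrightarrow> e mod n = x" for e
        proof -
          have "\<pi> e = \<pi> x \<longleftrightarrow> (int e - int r) mod int n = (int x - int r) mod int n"
            using n by (simp add: \<pi>_def eq_nat_nat_iff)
          also have "\<dots> \<longleftrightarrow> int e mod int n = int x mod int n"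
            by (simp add: mod_eq_dvd_iff)
          also have "\<dots> \<longleftrightarrow> e mod n = x"
            using x by (simp flip: zmod_int)
          finally show ?thesis .
        qed
        then show ?thesis by auto
      qed
      then show "ffact k (\<Sum>e | e \<in> ?C \<and> \<pi> e = \<pi> x. m e) = ffact k (\<Sum>e | e < n + t \<and> e mod n = x. m e)"
        by simp
    next
      fix x assume x: "x \<in> {0..<n}"
      show "\<pi> ((x + r) mod n) = x"
      proof -
        have "(int ((x + r) mod n) - int r) mod int n = (int x + int r - int r) mod int n"
          unfolding zmod_int of_nat_add by (rule mod_diff_left_eq)
        then show ?thesis using x by (simp add: \<pi>_def)
      qed
      show "(x + r) mod n \<in> {0..<n}" using n by simp
    qed
    finally show "of_nat (\<Prod>x\<in>{0..<n}. ffact (if x < n then k else 0) (\<Sum>e | e \<in> ?C \<and> \<pi> e = x. m e)) *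
        (if \<forall>e\<in>?C - ?C. m e = 0 then 1 else 0) =
      (\<Sum>\<alpha>\<in>?G. of_nat (\<Prod>e\<in>?C. ffact (?f \<alpha> e) (m e)) *
        (if mult_seq t (\<lambda>j. ?f \<alpha> (j - 1) - m (j - 1)) = \<alpha> then 1 else 0) :: 'a poly)"
      by simp
  qed
  also have "\<dots> = (\<Sum>\<alpha>\<in>?G. usage_op ?C ?u (n * k)
      (\<lambda>m. of_nat (\<Prod>e\<in>?C. ffact (?f \<alpha> e) (m e)) *
        (if mult_seq t (\<lambda>j. ?f \<alpha> (j - 1) - m (j - 1)) = \<alpha> then 1 else 0)))"
    by (rule usage_op_sum)
  also have "\<dots> = (\<Sum>\<alpha>\<in>?G. walk ?G (K_entry k t ?a) n \<alpha> \<alpha>)"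
  proof (intro sum.cong refl)
    fix \<alpha> assume \<alpha>: "\<alpha> \<in> ?G"
    have "usage_op ?C ?u (n * k)
      (\<lambda>m. of_nat (\<Prod>e\<in>?C. ffact (?f \<alpha> e) (m e)) *
        (if mult_seq t (\<lambda>j. ?f \<alpha> (j - 1) - m (j - 1)) = \<alpha> then 1 else 0)) =
      rook_op ?C ?u (\<lambda>h. if mult_seq t (\<lambda>j. h (j - 1)) = \<alpha> then 1 else 0) (n * k) (?f \<alpha>)"
      by (rule rook_op_eq_usage_op[symmetric]) simp
    also have "\<dots> = (\<Sum>\<gamma>\<in>?G. walk ?G (K_entry k t ?a) n \<alpha> \<gamma> * (if \<gamma> = \<alpha> then 1 else 0))"
      by (rule walk_K_eq_rook_op[OF k order_refl \<alpha>, symmetric])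
    also have "\<dots> = (\<Sum>\<gamma>\<in>{\<alpha>}. walk ?G (K_entry k t ?a) n \<alpha> \<gamma>)"
      using finite_G_set \<alpha> by (intro sum.mono_neutral_cong_right) auto
    finally show "usage_op ?C ?u (n * k)
      (\<lambda>m. of_nat (\<Prod>e\<in>?C. ffact (?f \<alpha> e) (m e)) *
        (if mult_seq t (\<lambda>j. ?f \<alpha> (j - 1) - m (j - 1)) = \<alpha> then 1 else 0)) =
      walk ?G (K_entry k t ?a) n \<alpha> \<alpha>" by simp
  qed
  finally show ?thesis .
qed

subsection \<open>Permanents\<close>

lemma coeff_mult_top:
  assumes "degree p \<le> i" "degree q \<le> j"
  shows "coeff (p * q) (i + j) = coeff p i * coeff q j"
proof -
  have "coeff (p * q) (i + j) = (\<Sum>l\<le>i + j. coeff p l * coeff q (i + j - l))"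
    by (rule coeff_mult)
  also have "\<dots> = (\<Sum>l\<in>{i}. coeff p l * coeff q (i + j - l))"
  proof (intro sum.mono_neutral_right)
    show "\<forall>l\<in>{..i + j} - {i}. coeff p l * coeff q (i + j - l) = 0"
    proof
      fix l assume l: "l \<in> {..i + j} - {i}"
      then have "degree p < l \<or> degree q < i + j - l"
        using assms by auto
      then show "coeff p l * coeff q (i + j - l) = 0"
        by (auto simp: coeff_eq_0)
    qed
  qed auto
  finally show ?thesis by simp
qed

text \<open>Coefficients at a degree bound multiply, even where they vanish, so extracting the
  coefficient of the k-th power of x commutes with forming matrix powers.\<close>

lemma walk_degree_top:
  fixes f :: "'i \<Rightarrow> 'i \<Rightarrow> 'a::comm_ring_1 poly"
  assumes f: "\<And>\<alpha> \<beta>. \<alpha> \<in> S \<Longrightarrow> \<beta> \<in> S \<Longrightarrow> degree (f \<alpha> \<beta>) \<le> k"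
    and \<alpha>: "\<alpha> \<in> S"
  shows "degree (walk S f n \<alpha> \<beta>) \<le> n * k \<and>
    coeff (walk S f n \<alpha> \<beta>) (n * k) = walk S (\<lambda>\<alpha> \<beta>. coeff (f \<alpha> \<beta>) k) n \<alpha> \<beta>"
  using \<alpha>
proof (induction n arbitrary: \<alpha>)
  case 0
  then show ?case by simp
next
  case (Suc n)
  have "degree (f \<alpha> \<gamma> * walk S f n \<gamma> \<beta>) \<le> k + n * k" if "\<gamma> \<in> S" for \<gamma>
    using f[OF Suc.prems that] Suc.IH[OF that]
    by (intro order.trans[OF degree_mult_le] add_mono) auto
  then have "degree (\<Sum>\<gamma>\<in>S. f \<alpha> \<gamma> * walk S f n \<gamma> \<beta>) \<le> k + n * k"
    by (cases "finite S") (auto intro: degree_sum_le)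
  moreover have "coeff (\<Sum>\<gamma>\<in>S. f \<alpha> \<gamma> * walk S f n \<gamma> \<beta>) (k + n * k) =
     (\<Sum>\<gamma>\<in>S. coeff (f \<alpha> \<gamma>) k * walk S (\<lambda>\<alpha> \<beta>. coeff (f \<alpha> \<beta>) k) n \<gamma> \<beta>)"
    unfolding coeff_sum using f[OF Suc.prems] Suc.IH
    by (intro sum.cong refl) (simp add: coeff_mult_top)
  ultimately show ?case by simp
qed

lemma G_lev_eq: "G_lev k l t = {\<alpha> \<in> G_set k t. (\<Sum>i = 1..t. count_list \<alpha> i) = l}"
  by (auto simp: G_lev_def G_set_def count_mult_seq)

text \<open>Each of the v + d rooks of a step contributes one x. As d is at most k - v, the degree
  stays below or at k when v is at most k.\<close>

lemma K_val_monom: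
  fixes b :: "nat \<Rightarrow> 'a::comm_ring_1"
  assumes "(\<Sum>i = 1..<t. p i) \<le> v"
  shows "K_val k t (\<lambda>i. monom (b i) 1) \<alpha> p v =
    (\<Sum>d = 0..min (count_list \<alpha> t) (k - v).
      monom (of_nat (\<Prod>i = 1..<t. count_list \<alpha> i choose p i) *
        of_nat (k choose (v - (\<Sum>i = 1..<t. p i))) * b 0 ^ (v - (\<Sum>i = 1..<t. p i)) *
        (\<Prod>i = 1..<t. b i ^ p i) *
        (of_nat (fact (d + v) * (k choose (d + v)) * (count_list \<alpha> t choose d)) * b t ^ d)) (v + d))"
proof -
  let ?s = "\<Sum>i = 1..<t. p i"
  have of_nat: "(of_nat m :: 'a poly) = monom (of_nat m) 0" for m
    by (simp add: monom_0 of_nat_poly)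
  have prod: "(\<Prod>i = 1..<t. monom (b i) 1 ^ p i) = monom (\<Prod>i = 1..<t. b i ^ p i) ?s"
  proof -
    have "(\<Prod>i\<in>S. monom (b i) 1 ^ p i) = monom (\<Prod>i\<in>S. b i ^ p i) (sum p S)" if "finite S" for S
      using that by (induction S) (simp_all add: monom_power mult_monom one_pCons monom_0)
    then show ?thesis by simp
  qed
  have "K_val k t (\<lambda>i. monom (b i) 1) \<alpha> p v =
      monom (of_nat (\<Prod>i = 1..<t. count_list \<alpha> i choose p i) *
        of_nat (k choose (v - ?s)) * b 0 ^ (v - ?s) * (\<Prod>i = 1..<t. b i ^ p i)) v *
      (\<Sum>d = 0..min (count_list \<alpha> t) (k - v).
        monom (of_nat (fact (d + v) * (k choose (d + v)) * (count_list \<alpha> t choose d)) * b t ^ d) d)"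
    unfolding K_val_def prod
    unfolding of_nat monom_power mult_monom using assms by simp
  then show ?thesis
    unfolding sum_distrib_left mult_monom .
qed

lemma degree_K_entry:
  fixes b :: "nat \<Rightarrow> 'a::comm_ring_1"
  shows "degree (K_entry k t (\<lambda>i. monom (b i) 1) \<alpha> \<beta>) \<le> k"
proof (cases "t = 0")
  case True
  have of_nat: "(of_nat m :: 'a poly) = monom (of_nat m) 0" for m
    by (simp add: monom_0 of_nat_poly)
  have "degree (\<Sum>d = 0..k. of_nat (fact d * (k choose d)\<^sup>2) * monom (b 0) 1 ^ d) \<le> k"
    unfolding of_nat monom_power mult_monom
    by (intro degree_sum_le) (auto intro: order.trans[OF degree_monom_le])
  then show ?thesis using True by (simp add: K_entry_def)
next
  case False
  show ?thesis
  proof (cases "K_adm k t \<alpha> \<beta> (p_of \<alpha> \<beta>) (v_of k t \<alpha> \<beta>)")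
    case True
    then have s: "(\<Sum>i = 1..<t. p_of \<alpha> \<beta> i) \<le> v_of k t \<alpha> \<beta>" "v_of k t \<alpha> \<beta> \<le> k"
      by (auto simp: K_adm_def)
    have "degree (K_val k t (\<lambda>i. monom (b i) 1) \<alpha> (p_of \<alpha> \<beta>) (v_of k t \<alpha> \<beta>)) \<le> k"
      unfolding K_val_monom[OF s(1)]
      by (intro degree_sum_le) (use s(2) in \<open>auto intro: order.trans[OF degree_monom_le]\<close>)
    then show ?thesis using False True by (simp add: K_entry_def)
  qed (use False in \<open>simp add: K_entry_def\<close>)
qed

lemma coeff_K_val:
  fixes b :: "nat \<Rightarrow> 'a::comm_ring_1"
  assumes "(\<Sum>i = 1..<t. p i) \<le> v" "v \<le> k"
  shows "coeff (K_val k t (\<lambda>i. monom (b i) 1) \<alpha> p v) k =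
    (if k - v \<le> count_list \<alpha> t then
      of_nat (\<Prod>i = 1..<t. count_list \<alpha> i choose p i) *
        of_nat (k choose (v - (\<Sum>i = 1..<t. p i))) * b 0 ^ (v - (\<Sum>i = 1..<t. p i)) *
        (\<Prod>i = 1..<t. b i ^ p i) *
        (of_nat (fact k * (count_list \<alpha> t choose (k - v))) * b t ^ (k - v)) else 0)"
proof -
  have "v + d = k \<longleftrightarrow> d = k - v" for d using assms(2) by auto
  then show ?thesis
    unfolding K_val_monom[OF assms(1)] coeff_sum coeff_monom
    using assms(2) by (simp add: sum.delta)
qed

text \<open>The k-th power of x means that every row of the block holds a rook, so d = k - v, which
  must not exceed the multiplicity of t in \<alpha>. By \<open>lev\<close> this bounds the level of
  \<beta> by that of \<alpha>, with equality exactly when the leaving block is exhausted; this is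
  the case that \<open>Pi_entry\<close> describes.\<close>

lemma coeff_K_entry:
  fixes b :: "nat \<Rightarrow> 'a::comm_ring_1"
  assumes \<alpha>: "\<alpha> \<in> G_set k t" and \<beta>: "\<beta> \<in> G_set k t"
    and le: "(\<Sum>i = 1..t. count_list \<alpha> i) \<le> (\<Sum>i = 1..t. count_list \<beta> i)"
  shows "coeff (K_entry k t (\<lambda>i. monom (b i) 1) \<alpha> \<beta>) k =
    (if (\<Sum>i = 1..t. count_list \<alpha> i) = (\<Sum>i = 1..t. count_list \<beta> i) then Pi_entry k t b \<alpha> \<beta> else 0)"
proof (cases "t = 0")
  case True
  have of_nat: "(of_nat m :: 'a poly) = monom (of_nat m) 0" for m
    by (simp add: monom_0 of_nat_poly)
  have "coeff (\<Sum>d = 0..k. of_nat (fact d * (k choose d)\<^sup>2) * monom (b 0) 1 ^ d) k = of_nat (fact k) * b 0 ^ k"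
    unfolding of_nat monom_power mult_monom coeff_sum coeff_monom by (simp add: sum.delta')
  then show ?thesis using True by (simp add: K_entry_def Pi_entry_def)
next
  case False
  then have t: "1 \<le> t" by simp
  let ?lt = "count_list \<alpha> t"
  have lt: "?lt \<le> k" by (rule count_list_G_set(1)[OF \<alpha>])
  \<comment> \<open>Column balance of a step: k new columns enter, v are used in blocks that remain,
    and block t leaves with all it had.\<close>
  have lev: "(\<Sum>i = 1..t. count_list \<alpha> i) + (k - v) = (\<Sum>i = 1..t. count_list \<beta> i) + ?lt"
    if adm: "K_adm k t \<alpha> \<beta> p v" for p v
  proof -
    have I: "{1..t} = insert t {1..<t}" "{1..t} = insert 1 {2..t}" using t by auto
    have "(\<Sum>i = 1..t. count_list \<beta> i) = count_list \<beta> 1 + (\<Sum>i = 2..t. count_list \<beta> i)"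
      by (subst I(2)) simp
    also have "count_list \<beta> 1 = k - v + (\<Sum>i = 1..<t. p i)"
      using adm t by (auto simp: K_adm_def shift_seq_def count_mult_seq)
    also have "(\<Sum>i = 2..t. count_list \<beta> i) = (\<Sum>i = 1..<t. count_list \<beta> (Suc i))"
    proof -
      have "{2..t} = {Suc 1..<Suc t}" by auto
      then show ?thesis by (simp only: sum.shift_bounds_Suc_ivl)
    qed
    also have "\<dots> = (\<Sum>i = 1..<t. count_list \<alpha> i - p i)"
      using adm by (intro sum.cong) (auto simp: K_adm_def shift_seq_def count_mult_seq)
    finally have "(\<Sum>i = 1..t. count_list \<beta> i) =
        (k - v) + ((\<Sum>i = 1..<t. p i) + (\<Sum>i = 1..<t. count_list \<alpha> i - p i))"
      by simp
    also have "(\<Sum>i = 1..<t. p i) + (\<Sum>i = 1..<t. count_list \<alpha> i - p i) = (\<Sum>i = 1..<t. count_list \<alpha> i)"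
      using adm unfolding sum.distrib[symmetric] by (intro sum.cong) (auto simp: K_adm_def)
    finally show ?thesis
      by (subst I(1)) simp
  qed
  show ?thesis
  proof (cases "\<exists>p v. K_adm k t \<alpha> \<beta> p v")
    case True
    then obtain p v where adm: "K_adm k t \<alpha> \<beta> p v" by blast
    let ?s = "\<Sum>i = 1..<t. p i"
    have sv: "?s \<le> v" "v \<le> k" using adm by (auto simp: K_adm_def)
    note K = K_entry_eq[OF t adm, where a = "\<lambda>i. monom (b i) 1"]
    show ?thesis
    proof (cases "(\<Sum>i = 1..t. count_list \<alpha> i) = (\<Sum>i = 1..t. count_list \<beta> i)")
      case True
      then have kv: "k - v = ?lt" using lev[OF adm] by simp
      then have v: "v = k - ?lt" using sv by simp
      have "Pi_adm k t \<alpha> \<beta> p"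
        using adm kv sv by (auto simp: Pi_adm_def K_adm_def)
      then have P: "Pi_entry k t b \<alpha> \<beta> = Pi_val k t b \<alpha> p" by (rule Pi_entry_eq[OF t])
      \<comment> \<open>The two definitions count block 0 from opposite sides: the columns used, and
        the columns left free.\<close>
      have "k choose (v - ?s) = k choose (?lt + ?s)"
        using sv lt v binomial_symmetric[of "v - ?s" k] by (simp add: add.commute)
      then show ?thesis
        unfolding K coeff_K_val[OF sv] P Pi_val_def kv
        using True by (simp add: v mult_ac)
    next
      case False
      then have "\<not> k - v \<le> ?lt" using lev[OF adm] le by linarith
      then show ?thesis
        unfolding K coeff_K_val[OF sv] using False by simp
    qed
  next
    case False
    have "\<nexists>p. Pi_adm k t \<alpha> \<beta> p"
    proof
      assume "\<exists>p. Pi_adm k t \<alpha> \<beta> p"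
      then obtain p where "Pi_adm k t \<alpha> \<beta> p" by blast
      then have "K_adm k t \<alpha> \<beta> p (k - ?lt)"
        using lt by (auto simp: Pi_adm_def K_adm_def)
      then show False using False by blast
    qed
    then have "Pi_entry k t b \<alpha> \<beta> = 0"
      by (rule Pi_entry_eq_0[OF t])
    then show ?thesis
      unfolding K_entry_eq_0[OF t False] by simp
  qed
qed

text \<open>Read as a polynomial in \<open>x\<close>, the coefficient of \<open>x\<^sup>k\<close> in \<open>K\<close> is block triangular with respect
  to the level \<open>r = \<Sum>l\<^sub>i\<close> and has the matrices \<open>\<Pi>\<^sub>r\<close> as its diagonal blocks.\<close>

lemma walk_top_block:
  fixes b :: "nat \<Rightarrow> 'a::comm_ring_1" and k t :: nat
  defines "f \<equiv> \<lambda>\<alpha> \<beta>. coeff (K_entry k t (\<lambda>i. monom (b i) 1) \<alpha> \<beta>) k"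
  assumes \<alpha>: "\<alpha> \<in> G_lev k l t" and \<beta>: "\<beta> \<in> G_lev k l' t" and "l \<le> l'"
  shows "walk (G_set k t) f n \<alpha> \<beta> = (if l = l' then walk (G_lev k l t) (Pi_entry k t b) n \<alpha> \<beta> else 0)"
  using \<alpha> \<open>l \<le> l'\<close>
proof (induction n arbitrary: \<alpha> l)
  case 0
  then show ?case using \<beta> by (auto simp: G_lev_eq)
next
  case (Suc n)
  let ?lev = "\<lambda>\<gamma>. \<Sum>i = 1..t. count_list \<gamma> i"
  have step: "f \<alpha> \<gamma> * walk (G_set k t) f n \<gamma> \<beta> =
      (if \<gamma> \<in> G_lev k l t \<and> l = l' then Pi_entry k t b \<alpha> \<gamma> * walk (G_lev k l t) (Pi_entry k t b) n \<gamma> \<beta> else 0)"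
    if \<gamma>: "\<gamma> \<in> G_set k t" for \<gamma>
  proof -
    have \<gamma>l: "\<gamma> \<in> G_lev k (?lev \<gamma>) t" using \<gamma> by (simp add: G_lev_eq)
    have \<alpha>l: "\<alpha> \<in> G_set k t" "?lev \<alpha> = l" using Suc.prems by (auto simp: G_lev_eq)
    \<comment> \<open>A step upwards has coefficient 0, and after a step downwards the walk can no
      longer climb to the target level. Only steps within level l survive.\<close>
    consider "?lev \<gamma> < l" | "?lev \<gamma> = l" | "l < ?lev \<gamma>" by linarith
    then show ?thesis
    proof cases
      case 1
      then have "walk (G_set k t) f n \<gamma> \<beta> = 0"
        using Suc.IH[OF \<gamma>l] Suc.prems by simp
      then show ?thesis using 1 by (auto simp: G_lev_eq)
    next
      case 2
      then have "f \<alpha> \<gamma> = Pi_entry k t b \<alpha> \<gamma>"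
        unfolding f_def using coeff_K_entry[OF \<alpha>l(1) \<gamma>, of b] \<alpha>l by simp
      moreover have "walk (G_set k t) f n \<gamma> \<beta> =
          (if l = l' then walk (G_lev k l t) (Pi_entry k t b) n \<gamma> \<beta> else 0)"
        using Suc.IH[OF \<gamma>l] Suc.prems 2 by simp
      ultimately show ?thesis using 2 \<gamma> by (simp add: G_lev_eq)
    next
      case 3
      then have "f \<alpha> \<gamma> = 0"
        unfolding f_def using coeff_K_entry[OF \<alpha>l(1) \<gamma>, of b] \<alpha>l by simp
      then show ?thesis using 3 by (auto simp: G_lev_eq)
    qed
  qed
  have "walk (G_set k t) f (Suc n) \<alpha> \<beta> = (\<Sum>\<gamma>\<in>G_set k t.
      if \<gamma> \<in> G_lev k l t \<and> l = l' then Pi_entry k t b \<alpha> \<gamma> * walk (G_lev k l t) (Pi_entry k t b) n \<gamma> \<beta> else 0)"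
    unfolding walk.simps using step by (intro sum.cong) auto
  also have "\<dots> = (if l = l' then \<Sum>\<gamma>\<in>G_lev k l t. Pi_entry k t b \<alpha> \<gamma> * walk (G_lev k l t) (Pi_entry k t b) n \<gamma> \<beta> else 0)"
  proof (cases "l = l'")
    case True
    then show ?thesis
      using finite_G_set[of k t]
      by (simp only: if_True simp_thms) (intro sum.mono_neutral_cong_right, auto simp: G_lev_eq)
  qed simp
  finally show ?case by simp
qed

lemma coeff_walk_K:
  fixes b :: "nat \<Rightarrow> 'a::comm_ring_1"
  assumes \<alpha>: "\<alpha> \<in> G_lev k l t" and \<beta>: "\<beta> \<in> G_lev k l' t" and "l \<le> l'"
  shows "coeff (walk (G_set k t) (K_entry k t (\<lambda>i. monom (b i) 1)) n \<alpha> \<beta>) (n * k) =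
    (if l = l' then walk (G_lev k l t) (Pi_entry k t b) n \<alpha> \<beta> else 0)"
proof -
  have "\<alpha> \<in> G_set k t" using \<alpha> by (simp add: G_lev_eq)
  then have "coeff (walk (G_set k t) (K_entry k t (\<lambda>i. monom (b i) 1)) n \<alpha> \<beta>) (n * k) =
      walk (G_set k t) (\<lambda>\<alpha> \<beta>. coeff (K_entry k t (\<lambda>i. monom (b i) 1) \<alpha> \<beta>) k) n \<alpha> \<beta>"
    using degree_K_entry by (intro walk_degree_top[THEN conjunct2])
  then show ?thesis unfolding walk_top_block[OF assms] .
qed

lemma per_kronecker_ones:
  assumes "A \<in> carrier_mat n n"
  shows "per (kronecker A (ones_mat k)) = coeff (rook_poly (kronecker A (ones_mat k))) (n * k)"
proof -
  have "dim_row (kronecker A (ones_mat k)) = n * k" "dim_col (kronecker A (ones_mat k)) = n * k"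
    using assms by (simp_all add: kronecker_def ones_mat_def)
  then show ?thesis
    using coeff_rook_poly_top[of "kronecker A (ones_mat k)"] by simp
qed

lemma full_seq_in_G_lev: "r \<le> t \<Longrightarrow> mult_seq r (\<lambda>_. k) \<in> G_lev k (r * k) t"
proof -
  assume r: "r \<le> t"
  have "(\<Sum>i = 1..t. count_list (mult_seq r (\<lambda>_. k)) i) = (\<Sum>i = 1..r. k)"
    using r by (intro sum.mono_neutral_cong_right) (auto simp: count_mult_seq)
  then show ?thesis using full_seq_in_G_set[OF r] by (simp add: G_lev_eq)
qed

text \<open>Any end state that contains \<delta> properly has level above r k, which a walk from
  \<delta> with every row occupied cannot reach. The sum over end states shrinks to the single
  diagonal entry at \<delta>.\<close>

lemma per_toeplitz:
  fixes b :: "nat \<Rightarrow> 'a::comm_ring_1"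
  assumes k: "1 \<le> k" and r: "r \<le> t"
  shows "per (kronecker (mat_sum n (\<lambda>i. b i \<cdot>\<^sub>m toeplitz_unit n (int i - int r)) {0..t}) (ones_mat k)) =
    walk (G_lev k (r * k) t) (Pi_entry k t b) n (mult_seq r (\<lambda>_. k)) (mult_seq r (\<lambda>_. k))"
proof -
  let ?\<delta> = "mult_seq r (\<lambda>_. k)" and ?lev = "\<lambda>\<gamma>. \<Sum>i = 1..t. count_list \<gamma> i"
  let ?S = "{\<gamma>. \<gamma> \<in> G_set k t \<and> (\<forall>i\<in>{1..r}. count_list \<gamma> i = k)}"
  let ?W = "\<lambda>\<gamma>. walk (G_set k t) (K_entry k t (\<lambda>i. monom (b i) 1)) n ?\<delta> \<gamma>"
  have \<delta>: "?\<delta> \<in> G_lev k (r * k) t" by (rule full_seq_in_G_lev[OF r])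
  have "mat_sum n (\<lambda>i. b i \<cdot>\<^sub>m toeplitz_unit n (int i - int r)) {0..t} \<in> carrier_mat n n"
    by (simp add: mat_sum_def)
  from per_kronecker_ones[OF this, of k]
  have "per (kronecker (mat_sum n (\<lambda>i. b i \<cdot>\<^sub>m toeplitz_unit n (int i - int r)) {0..t}) (ones_mat k)) =
      (\<Sum>\<gamma>\<in>?S. coeff (?W \<gamma>) (n * k))"
    unfolding rook_poly_toeplitz[OF k r] coeff_sum .
  also have "\<dots> = (\<Sum>\<gamma>\<in>{?\<delta>}. coeff (?W \<gamma>) (n * k))"
  proof (intro sum.mono_neutral_right)
    show "finite ?S" using finite_G_set by simp
    show "{?\<delta>} \<subseteq> ?S" using full_seq_in_G_set[OF r] by (auto simp: count_mult_seq)
    show "\<forall>\<gamma>\<in>?S - {?\<delta>}. coeff (?W \<gamma>) (n * k) = 0"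
    proof
      fix \<gamma> assume \<gamma>: "\<gamma> \<in> ?S - {?\<delta>}"
      then have G: "\<gamma> \<in> G_lev k (?lev \<gamma>) t" by (simp add: G_lev_eq)
      have I: "{1..t} = {1..r} \<union> {r<..t}" using r by auto
      have lev: "?lev \<gamma> = r * k + (\<Sum>i\<in>{r<..t}. count_list \<gamma> i)"
        unfolding I using \<gamma> by (subst sum.union_disjoint) auto
      have "\<exists>i\<in>{r<..t}. count_list \<gamma> i \<noteq> 0"
      proof (rule ccontr)
        assume *: "\<not> (\<exists>i\<in>{r<..t}. count_list \<gamma> i \<noteq> 0)"
        have "\<gamma> = ?\<delta>"
          using \<gamma> * by (intro G_set_eqI[OF _ full_seq_in_G_set[OF r]]) (auto simp: count_mult_seq)
        then show False using \<gamma> by simp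
      qed
      then have "0 < (\<Sum>i\<in>{r<..t}. count_list \<gamma> i)"
        by (meson finite_greaterThanAtMost gr_zeroI sum_eq_0_iff)
      then have "r * k < ?lev \<gamma>" using lev by simp
      then show "coeff (?W \<gamma>) (n * k) = 0"
        using coeff_walk_K[OF \<delta> G, of b n] by simp
    qed
  qed
  also have "\<dots> = walk (G_lev k (r * k) t) (Pi_entry k t b) n ?\<delta> ?\<delta>"
    using coeff_walk_K[OF \<delta> \<delta>, of b n] by simp
  finally show ?thesis .
qed

lemma G_set_eq_Union: "G_set k t = (\<Union>l\<in>{0..k * t}. G_lev k l t)"
proof -
  have "(\<Sum>i = 1..t. count_list \<alpha> i) \<le> k * t" if "\<alpha> \<in> G_set k t" for \<alpha>
    using sum_bounded_above[of "{1..t}" "count_list \<alpha>" k] count_list_G_set(1)[OF that]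
    by (simp add: mult.commute)
  then show ?thesis by (auto simp: G_lev_eq)
qed

text \<open>The trace of a power of a block triangular matrix is the sum of the traces of the powers
  of its diagonal blocks, here one for each level.\<close>

lemma per_circulant:
  fixes b :: "nat \<Rightarrow> 'a::comm_ring_1"
  assumes k: "1 \<le> k" and n: "1 \<le> n"
  shows "per (kronecker (mat_sum n (\<lambda>i. b i \<cdot>\<^sub>m int_pow_mat (cyclic_mat n) (int i - int r)) {0..t}) (ones_mat k)) =
    (\<Sum>l = 0..k * t. \<Sum>\<alpha>\<in>G_lev k l t. walk (G_lev k l t) (Pi_entry k t b) n \<alpha> \<alpha>)"
proof -
  let ?W = "\<lambda>\<alpha>. walk (G_set k t) (K_entry k t (\<lambda>i. monom (b i) 1)) n \<alpha> \<alpha>"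
  have "mat_sum n (\<lambda>i. b i \<cdot>\<^sub>m int_pow_mat (cyclic_mat n) (int i - int r)) {0..t} \<in> carrier_mat n n"
    by (simp add: mat_sum_def)
  from per_kronecker_ones[OF this, of k]
  have "per (kronecker (mat_sum n (\<lambda>i. b i \<cdot>\<^sub>m int_pow_mat (cyclic_mat n) (int i - int r)) {0..t}) (ones_mat k)) =
      (\<Sum>\<alpha>\<in>G_set k t. coeff (?W \<alpha>) (n * k))"
    unfolding rook_poly_circulant[OF k n] coeff_sum .
  also have "\<dots> = (\<Sum>l\<in>{0..k * t}. \<Sum>\<alpha>\<in>G_lev k l t. coeff (?W \<alpha>) (n * k))"
    unfolding G_set_eq_Union[of k t]
    using finite_G_set[of k t] by (intro sum.UNION_disjoint) (auto simp: G_lev_eq)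
  also have "\<dots> = (\<Sum>l = 0..k * t. \<Sum>\<alpha>\<in>G_lev k l t. walk (G_lev k l t) (Pi_entry k t b) n \<alpha> \<alpha>)"
    using coeff_walk_K[of _ k _ t _ _ b n] by (intro sum.cong refl) simp
  finally show ?thesis .
qed

subsection \<open>Generating functions\<close>

lemma indexed_mat_carrier: "indexed_mat L S f \<in> carrier_mat (card S) (card S)"
  by (simp add: indexed_mat_def)

lemma trace_indexed_mat_pow:
  assumes num: "numbering L S"
  shows "(\<Sum>i<card S. (indexed_mat L S f ^\<^sub>m n) $$ (i, i)) = (\<Sum>\<alpha>\<in>S. walk S f n \<alpha> \<alpha>)"
proof -
  have "(\<Sum>i<card S. (indexed_mat L S f ^\<^sub>m n) $$ (i, i)) =
      (\<Sum>i<card S. walk S f n (inv_into S L (Suc i)) (inv_into S L (Suc i)))"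
  proof (intro sum.cong refl)
    fix i assume "i \<in> {..<card S}"
    then have "Suc i \<in> L ` S"
      using num unfolding numbering_def bij_betw_def by auto
    then have "inv_into S L (Suc i) \<in> S" "L (inv_into S L (Suc i)) - 1 = i"
      by (auto simp: inv_into_into f_inv_into_f)
    then show "(indexed_mat L S f ^\<^sub>m n) $$ (i, i) = walk S f n (inv_into S L (Suc i)) (inv_into S L (Suc i))"
      using indexed_mat_pow[OF num, of "inv_into S L (Suc i)" "inv_into S L (Suc i)" f n] by simp
  qed
  also have "\<dots> = (\<Sum>\<alpha>\<in>S. walk S f n \<alpha> \<alpha>)"
    by (rule sum_numbering[OF num])
  finally show ?thesis .
qed

text \<open>Cramer's rule for I - yA. The deleted row belongs to the end \<beta> of the walk and the
  deleted column to its start \<alpha>, by the transposition in the adjugate.\<close>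

lemma walk_series:
  fixes f :: "'i \<Rightarrow> 'i \<Rightarrow> 'a::comm_ring_1"
  assumes num: "numbering L S" and \<alpha>: "\<alpha> \<in> S" and \<beta>: "\<beta> \<in> S"
  defines "M \<equiv> char_series_mat (card S) (indexed_mat L S f)"
  shows "Abs_fps (\<lambda>n. walk S f n \<alpha> \<beta>) =
    (- 1) ^ L \<alpha> * ((- 1) ^ L \<beta> * det (submat_del M (L \<beta>) (L \<alpha>))) * fps_inv1 (det M)"
proof -
  note b = numbering_bounds[OF num \<alpha>] numbering_bounds[OF num \<beta>]
  obtain i j where ij: "L \<alpha> = Suc i" "L \<beta> = Suc j"
    using b(1,4) by (cases "L \<alpha>"; cases "L \<beta>") auto
  \<comment> \<open>Rows are counted from 0 in the cofactor and from 1 by \<open>L\<close>; the two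
    shifts change the exponent by 2.\<close>
  have sign: "(- 1 :: 'a fps) ^ (L \<beta> - 1 + (L \<alpha> - 1)) = (- 1) ^ L \<alpha> * (- 1) ^ L \<beta>"
    unfolding ij diff_Suc_1 power_add power_Suc by (simp add: mult.commute)
  have "Abs_fps (\<lambda>n. walk S f n \<alpha> \<beta>) = Abs_fps (\<lambda>n. (indexed_mat L S f ^\<^sub>m n) $$ (L \<alpha> - 1, L \<beta> - 1))"
    unfolding indexed_mat_pow[OF num \<alpha> \<beta>] ..
  also have "\<dots> = cofactor M (L \<beta> - 1) (L \<alpha> - 1) * fps_inv1 (det M)"
    unfolding M_def by (rule resolvent_cofactor[OF indexed_mat_carrier b(2,5)])
  also have "\<dots> = (- 1) ^ L \<alpha> * ((- 1) ^ L \<beta> * det (submat_del M (L \<beta>) (L \<alpha>))) * fps_inv1 (det M)"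
    unfolding cofactor_def sign submat_del_def by (simp only: mult.assoc)
  finally show ?thesis .
qed

text \<open>No letter occurs more than k times in \<gamma>, so containing k copies of it means
  having exactly k.\<close>

lemma full_seq_subseteq_iff:
  assumes "\<gamma> \<in> G_set k t"
  shows "mset (mult_seq r (\<lambda>_. k)) \<subseteq># mset \<gamma> \<longleftrightarrow> (\<forall>i\<in>{1..r}. count_list \<gamma> i = k)"
proof -
  have "mset (mult_seq r (\<lambda>_. k)) \<subseteq># mset \<gamma> \<longleftrightarrow>
      (\<forall>i. (if 1 \<le> i \<and> i \<le> r then k else 0) \<le> count_list \<gamma> i)"
    by (simp add: subseteq_mset_def count_mset count_mult_seq)
  also have "\<dots> \<longleftrightarrow> (\<forall>i\<in>{1..r}. k \<le> count_list \<gamma> i)"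
    by auto
  also have "\<dots> \<longleftrightarrow> (\<forall>i\<in>{1..r}. count_list \<gamma> i = k)"
    using count_list_G_set(1)[OF assms] by (auto intro: antisym)
  finally show ?thesis .
qed

lemma full_supersets_eq:
  assumes r: "r \<le> t"
  shows "{\<gamma> \<in> (\<Union>l\<in>{r * k..k * t}. G_lev k l t). mset (mult_seq r (\<lambda>_. k)) \<subseteq># mset \<gamma>} =
    {\<gamma>. \<gamma> \<in> G_set k t \<and> (\<forall>i\<in>{1..r}. count_list \<gamma> i = k)}"
proof (intro equalityI subsetI)
  fix \<gamma> assume "\<gamma> \<in> {\<gamma> \<in> (\<Union>l\<in>{r * k..k * t}. G_lev k l t). mset (mult_seq r (\<lambda>_. k)) \<subseteq># mset \<gamma>}"
  then show "\<gamma> \<in> {\<gamma>. \<gamma> \<in> G_set k t \<and> (\<forall>i\<in>{1..r}. count_list \<gamma> i = k)}"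
    using full_seq_subseteq_iff[of \<gamma> k t r] by (auto simp: G_lev_eq)
next
  fix \<gamma> assume \<gamma>: "\<gamma> \<in> {\<gamma>. \<gamma> \<in> G_set k t \<and> (\<forall>i\<in>{1..r}. count_list \<gamma> i = k)}"
  then obtain l where l: "l \<le> k * t" "\<gamma> \<in> G_lev k l t"
    unfolding G_set_eq_Union[of k t] by auto
  have "r * k = (\<Sum>i\<in>{1..r}. count_list \<gamma> i)" using \<gamma> by simp
  also have "\<dots> \<le> (\<Sum>i\<in>{1..t}. count_list \<gamma> i)" using r by (intro sum_mono2) auto
  also have "\<dots> = l" using l by (simp add: G_lev_eq)
  finally show "\<gamma> \<in> {\<gamma> \<in> (\<Union>l\<in>{r * k..k * t}. G_lev k l t). mset (mult_seq r (\<lambda>_. k)) \<subseteq># mset \<gamma>}"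
    using l \<gamma> full_seq_subseteq_iff[of \<gamma> k t r] by auto
qed

lemma series_from_1_cong: "(\<And>n. 1 \<le> n \<Longrightarrow> f n = g n) \<Longrightarrow> series_from_1 f = series_from_1 g"
  by (rule fps_ext) (simp add: series_from_1_def)

lemma series_from_1_sum: "series_from_1 (\<lambda>n. \<Sum>l\<in>S. f l n) = (\<Sum>l\<in>S. series_from_1 (f l))"
  by (rule fps_ext) (simp add: series_from_1_def fps_sum_nth)

theorem theorem22:
  fixes k r t :: nat
    and a :: "int \<Rightarrow> 'a::comm_ring_1"
    and L :: "nat list \<Rightarrow> nat"
    and L' :: "nat \<Rightarrow> nat list \<Rightarrow> nat"
  assumes "1 \<le> k" and "r \<le> t"
    and "numbering L (G_set k t)"
    and "\<forall>l\<le>k * t. numbering (L' l) (G_lev k l t)"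
  shows
    "let b = (\<lambda>i. a (int i - int r));
         M = char_series_mat ((k + 1) ^ t) (K_mat L k t (\<lambda>i. monom (b i) 1));
         Q = (\<lambda>l. char_series_mat (card (G_lev k l t)) (Pi_mat (L' l) k l t b));
         \<delta> = mult_seq r (\<lambda>_. k);
         T = (\<lambda>n. mat_sum n (\<lambda>i. b i \<cdot>\<^sub>m toeplitz_unit n (int i - int r)) {0..t});
         P = (\<lambda>n. mat_sum n (\<lambda>i. b i \<cdot>\<^sub>m int_pow_mat (cyclic_mat n) (int i - int r)) {0..t})
     in
       1 + series_from_1 (\<lambda>n. rook_poly (kronecker (T n) (ones_mat k))) =
         (- 1) ^ L \<delta> *
         (\<Sum>\<gamma> \<in> {\<gamma> \<in> (\<Union>l\<in>{r * k..k * t}. G_lev k l t). mset \<delta> \<subseteq># mset \<gamma>}.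
            (- 1) ^ L \<gamma> * det (submat_del M (L \<gamma>) (L \<delta>))) *
         fps_inv1 (det M)
     \<and> series_from_1 (\<lambda>n. rook_poly (kronecker (P n) (ones_mat k))) =
         - fps_X * fps_deriv (det M) * fps_inv1 (det M)
     \<and> 1 + series_from_1 (\<lambda>n. per (kronecker (T n) (ones_mat k))) =
         det (submat_del (Q (r * k)) (L' (r * k) \<delta>) (L' (r * k) \<delta>)) * fps_inv1 (det (Q (r * k)))
     \<and> series_from_1 (\<lambda>n. per (kronecker (P n) (ones_mat k))) =
         - fps_X * (\<Sum>l = 0..k * t. fps_deriv (det (Q l)) * fps_inv1 (det (Q l)))"
proof -
  define b where "b = (\<lambda>i. a (int i - int r))"
  let ?K = "K_entry k t (\<lambda>i. monom (b i) 1)" and ?G = "G_set k t" and ?\<delta> = "mult_seq r (\<lambda>_. k)"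
  let ?\<Pi> = "Pi_entry k t b"
  define M where "M = char_series_mat ((k + 1) ^ t) (K_mat L k t (\<lambda>i. monom (b i) 1))"
  define Q where "Q = (\<lambda>l. char_series_mat (card (G_lev k l t)) (Pi_mat (L' l) k l t b))"
  define T where "T = (\<lambda>n. mat_sum n (\<lambda>i. b i \<cdot>\<^sub>m toeplitz_unit n (int i - int r)) {0..t})"
  define P where "P = (\<lambda>n. mat_sum n (\<lambda>i. b i \<cdot>\<^sub>m int_pow_mat (cyclic_mat n) (int i - int r)) {0..t})"
  note k = \<open>1 \<le> k\<close> and r = \<open>r \<le> t\<close> and L = \<open>numbering L ?G\<close>
  have L': "numbering (L' l) (G_lev k l t)" if "l \<le> k * t" for l
    using assms(4) that by blast
  have M: "M = char_series_mat (card ?G) (indexed_mat L ?G ?K)"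
    by (simp add: M_def K_mat_def card_G_set)
  have Q: "Q l = char_series_mat (card (G_lev k l t)) (indexed_mat (L' l) (G_lev k l t) ?\<Pi>)" for l
    by (simp add: Q_def Pi_mat_def)
  have \<delta>: "?\<delta> \<in> ?G" by (rule full_seq_in_G_set[OF r])
  have \<delta>': "?\<delta> \<in> G_lev k (r * k) t" by (rule full_seq_in_G_lev[OF r])
  let ?S = "{\<gamma>. \<gamma> \<in> ?G \<and> (\<forall>i\<in>{1..r}. count_list \<gamma> i = k)}"
  have "1 + series_from_1 (\<lambda>n. rook_poly (kronecker (T n) (ones_mat k))) =
      (\<Sum>\<gamma>\<in>?S. Abs_fps (\<lambda>n. walk ?G ?K n ?\<delta> \<gamma>))"
  proof (rule fps_ext)
    fix n
    \<comment> \<open>The summand 1 on the left comes from walks of length 0: they end in \<delta>,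
      which is itself an admissible end state.\<close>
    have "(\<Sum>\<gamma>\<in>?S. walk ?G ?K 0 ?\<delta> \<gamma>) = (\<Sum>\<gamma>\<in>{?\<delta>}. 1)"
      using \<delta> r finite_G_set by (intro sum.mono_neutral_cong_right) (auto simp: count_mult_seq)
    then show "fps_nth (1 + series_from_1 (\<lambda>n. rook_poly (kronecker (T n) (ones_mat k)))) n =
        fps_nth (\<Sum>\<gamma>\<in>?S. Abs_fps (\<lambda>n. walk ?G ?K n ?\<delta> \<gamma>)) n"
      unfolding T_def
      by (cases "n = 0") (simp_all add: series_from_1_def fps_sum_nth rook_poly_toeplitz[OF k r])
  qed
  also have "\<dots> = (\<Sum>\<gamma>\<in>?S. (- 1) ^ L ?\<delta> * ((- 1) ^ L \<gamma> * det (submat_del M (L \<gamma>) (L ?\<delta>))) * fps_inv1 (det M))"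
    unfolding M by (intro sum.cong refl walk_series[OF L \<delta>]) simp
  also have "\<dots> = (- 1) ^ L ?\<delta> *
      (\<Sum>\<gamma> \<in> {\<gamma> \<in> (\<Union>l\<in>{r * k..k * t}. G_lev k l t). mset ?\<delta> \<subseteq># mset \<gamma>}.
         (- 1) ^ L \<gamma> * det (submat_del M (L \<gamma>) (L ?\<delta>))) * fps_inv1 (det M)"
    unfolding full_supersets_eq[OF r] sum_distrib_left sum_distrib_right ..
  finally have rook_T: "1 + series_from_1 (\<lambda>n. rook_poly (kronecker (T n) (ones_mat k))) = \<dots>" .
  have rook_P: "series_from_1 (\<lambda>n. rook_poly (kronecker (P n) (ones_mat k))) =
      - fps_X * fps_deriv (det M) * fps_inv1 (det M)"
    unfolding M log_deriv_det_char_series_mat[OF indexed_mat_carrier] trace_indexed_mat_pow[OF L] P_def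
    by (intro series_from_1_cong rook_poly_circulant[OF k])
  have "1 + series_from_1 (\<lambda>n. per (kronecker (T n) (ones_mat k))) =
      Abs_fps (\<lambda>n. walk (G_lev k (r * k) t) ?\<Pi> n ?\<delta> ?\<delta>)"
    unfolding T_def per_toeplitz[OF k r] by (rule fps_ext) (simp add: series_from_1_def)
  also have "\<dots> = (- 1) ^ L' (r * k) ?\<delta> * ((- 1) ^ L' (r * k) ?\<delta> *
      det (submat_del (Q (r * k)) (L' (r * k) ?\<delta>) (L' (r * k) ?\<delta>))) * fps_inv1 (det (Q (r * k)))"
    unfolding Q using r by (intro walk_series[OF L' \<delta>' \<delta>']) simp
  \<comment> \<open>Start and end coincide, so the two signs cancel.\<close>
  also have "\<dots> = det (submat_del (Q (r * k)) (L' (r * k) ?\<delta>) (L' (r * k) ?\<delta>)) * fps_inv1 (det (Q (r * k)))"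
    by (simp add: mult.assoc[symmetric] power_mult_distrib[symmetric])
  finally have per_T: "1 + series_from_1 (\<lambda>n. per (kronecker (T n) (ones_mat k))) = \<dots>" .
  have "series_from_1 (\<lambda>n. per (kronecker (P n) (ones_mat k))) =
      series_from_1 (\<lambda>n. \<Sum>l = 0..k * t. \<Sum>\<alpha>\<in>G_lev k l t. walk (G_lev k l t) ?\<Pi> n \<alpha> \<alpha>)"
    unfolding P_def by (intro series_from_1_cong per_circulant[OF k])
  also have "\<dots> = (\<Sum>l = 0..k * t. - fps_X * fps_deriv (det (Q l)) * fps_inv1 (det (Q l)))"
  proof (subst series_from_1_sum, intro sum.cong refl)
    fix l assume "l \<in> {0..k * t}"
    then have "numbering (L' l) (G_lev k l t)" by (intro L') simp
    then show "series_from_1 (\<lambda>n. \<Sum>\<alpha>\<in>G_lev k l t. walk (G_lev k l t) ?\<Pi> n \<alpha> \<alpha>) =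
        - fps_X * fps_deriv (det (Q l)) * fps_inv1 (det (Q l))"
      unfolding Q log_deriv_det_char_series_mat[OF indexed_mat_carrier] by (simp only: trace_indexed_mat_pow)
  qed
  also have "\<dots> = - fps_X * (\<Sum>l = 0..k * t. fps_deriv (det (Q l)) * fps_inv1 (det (Q l)))"
    by (simp only: sum_distrib_left mult.assoc)
  finally have per_P: "series_from_1 (\<lambda>n. per (kronecker (P n) (ones_mat k))) = \<dots>" .
  show ?thesis
    unfolding Let_def
    using rook_T rook_P per_T per_P
    unfolding M_def Q_def T_def P_def b_def by blast
qed

end
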